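(* Let $\phi : M^2\to\mathbb{R}^4\equiv\mathbb{C}^2$ be an isometric immersion of a compact surface which is Lagrangian and a self-shrinker, i.e. $H=-\phi^\perp$. If $|H|^2$ is constant, or $|H|^2\le 2$ everywhere on $M$, or $|H|^2\ge 2$ everywhere on $M$, then $M$ is the Clifford torus $\mathbb{S}^1\times\mathbb{S}^1$ (the product of two unit circles centered at the origin in $\mathbb{C}\times\mathbb{C}$).
   Context: $H=\operatorname{trace}\sigma$ is the (unnormalized) mean curvature vector of $\phi$, $\sigma$ its second fundamental form, and $\phi^\perp$ the normal projection of the position vector. A self-shrinker is an immersion with $H=-\phi^\perp$. The immersion is Lagrangian if the Kähler form $\omega(\cdot,\cdot)=\langle J\cdot,\cdot\rangle$ of $\mathbb{C}^2$ (with $J$ the standard complex structure) restricts to zero on $M$. The identification with the Clifford torus is up to a linear isometry of $\mathbb{R}^4$. *)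

theory Defs
  imports "HOL-Analysis.Analysis"
begin

text \<open>Ambient space: C^2 = complex^2 (real inner product Re of hermitian product,
  i.e. the Euclidean structure of R^4). Parameter space of local charts: real^2.\<close>

definition dirD :: "('a::real_normed_vector \<Rightarrow> 'b::real_normed_vector) \<Rightarrow> 'a \<Rightarrow> 'a \<Rightarrow> 'b" where
  "dirD f e p = frechet_derivative f (at p) e"

fun Ck_on :: "nat \<Rightarrow> ('a::euclidean_space \<Rightarrow> 'b::euclidean_space) \<Rightarrow> 'a set \<Rightarrow> bool" where
  "Ck_on 0 f V = continuous_on V f"
| "Ck_on (Suc k) f V = (f differentiable_on V \<and> (\<forall>e. Ck_on k (dirD f e) V))"

definition smooth_on :: "('a::euclidean_space \<Rightarrow> 'b::euclidean_space) \<Rightarrow> 'a set \<Rightarrow> bool" where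
  "smooth_on f V = (\<forall>k. Ck_on k f V)"

definition e1 :: "real^2" where "e1 = axis 1 1"
definition e2 :: "real^2" where "e2 = axis 2 1"

definition fu where "fu f u = dirD f e1 u"
definition fv where "fv f u = dirD f e2 u"
definition fuu where "fuu f u = dirD (dirD f e1) e1 u"
definition fuv where "fuv f u = dirD (dirD f e1) e2 u"
definition fvv where "fvv f u = dirD (dirD f e2) e2 u"

definition g11 :: "(real^2 \<Rightarrow> complex^2) \<Rightarrow> real^2 \<Rightarrow> real" where "g11 f u = fu f u \<bullet> fu f u"
definition g12 :: "(real^2 \<Rightarrow> complex^2) \<Rightarrow> real^2 \<Rightarrow> real" where "g12 f u = fu f u \<bullet> fv f u"
definition g22 :: "(real^2 \<Rightarrow> complex^2) \<Rightarrow> real^2 \<Rightarrow> real" where "g22 f u = fv f u \<bullet> fv f u"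
definition gdet where "gdet f u = g11 f u * g22 f u - (g12 f u)^2"
definition gi11 where "gi11 f u = g22 f u / gdet f u"
definition gi12 where "gi12 f u = - g12 f u / gdet f u"
definition gi22 where "gi22 f u = g11 f u / gdet f u"

definition tan_proj :: "(real^2 \<Rightarrow> complex^2) \<Rightarrow> real^2 \<Rightarrow> complex^2 \<Rightarrow> complex^2" where
  "tan_proj f u w =
     (gi11 f u * (w \<bullet> fu f u) + gi12 f u * (w \<bullet> fv f u)) *\<^sub>R fu f u +
     (gi12 f u * (w \<bullet> fu f u) + gi22 f u * (w \<bullet> fv f u)) *\<^sub>R fv f u"
definition nor_proj :: "(real^2 \<Rightarrow> complex^2) \<Rightarrow> real^2 \<Rightarrow> complex^2 \<Rightarrow> complex^2" where
  "nor_proj f u w = w - tan_proj f u w"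

text \<open>second fundamental form sigma(d_i,d_j) = (f_ij)^perp, and the (unnormalised) mean
  curvature vector H = trace sigma = g^{ij} sigma(d_i,d_j).\<close>
definition mean_curv :: "(real^2 \<Rightarrow> complex^2) \<Rightarrow> real^2 \<Rightarrow> complex^2" where
  "mean_curv f u = gi11 f u *\<^sub>R nor_proj f u (fuu f u) + (2 * gi12 f u) *\<^sub>R nor_proj f u (fuv f u)
                   + gi22 f u *\<^sub>R nor_proj f u (fvv f u)"

definition Jc :: "complex^2 \<Rightarrow> complex^2" where "Jc w = (\<chi> k. \<i> * w $ k)"
definition kaehler :: "complex^2 \<Rightarrow> complex^2 \<Rightarrow> real" where "kaehler v w = Jc v \<bullet> w"

definition imm_chart :: "'a topology \<Rightarrow> ('a \<Rightarrow> complex^2) \<Rightarrow> (real^2 \<Rightarrow> 'a) \<Rightarrow> (real^2) set \<Rightarrow> bool" where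
  "imm_chart M \<phi> x V \<longleftrightarrow> open V \<and> openin M (x ` V) \<and>
     homeomorphic_map (subtopology euclidean V) (subtopology M (x ` V)) x \<and>
     smooth_on (\<phi> \<circ> x) V \<and> (\<forall>u\<in>V. inj (frechet_derivative (\<phi> \<circ> x) (at u)))"

text \<open>phi : M \<rightarrow> C^2 is an immersion of the compact (connected) surface M, with the
  induced metric (so it is isometric), the smooth structure being given by the charts.\<close>
definition compact_immersed_surface :: "'a topology \<Rightarrow> ('a \<Rightarrow> complex^2) \<Rightarrow> bool" where
  "compact_immersed_surface M \<phi> \<longleftrightarrow> compact_space M \<and> Hausdorff_space M \<and> connected_space M \<and>
     topspace M \<noteq> {} \<and>
     (\<forall>p\<in>topspace M. \<exists>x V. imm_chart M \<phi> x V \<and> p \<in> x ` V)"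

definition lagrangian :: "'a topology \<Rightarrow> ('a \<Rightarrow> complex^2) \<Rightarrow> bool" where
  "lagrangian M \<phi> \<longleftrightarrow> (\<forall>x V. imm_chart M \<phi> x V \<longrightarrow>
     (\<forall>u\<in>V. kaehler (fu (\<phi> \<circ> x) u) (fv (\<phi> \<circ> x) u) = 0))"

definition self_shrinker :: "'a topology \<Rightarrow> ('a \<Rightarrow> complex^2) \<Rightarrow> bool" where
  "self_shrinker M \<phi> \<longleftrightarrow> (\<forall>x V. imm_chart M \<phi> x V \<longrightarrow>
     (\<forall>u\<in>V. mean_curv (\<phi> \<circ> x) u = - nor_proj (\<phi> \<circ> x) u ((\<phi> \<circ> x) u)))"

definition H_sq_holds :: "'a topology \<Rightarrow> ('a \<Rightarrow> complex^2) \<Rightarrow> (real \<Rightarrow> bool) \<Rightarrow> bool" where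
  "H_sq_holds M \<phi> P \<longleftrightarrow> (\<forall>x V. imm_chart M \<phi> x V \<longrightarrow>
     (\<forall>u\<in>V. P ((norm (mean_curv (\<phi> \<circ> x) u))\<^sup>2)))"

definition clifford_torus :: "(complex^2) set" where
  "clifford_torus = {z. cmod (z $ 1) = 1 \<and> cmod (z $ 2) = 1}"

end

theory Submission
  imports Defs
begin

text \<open>
  On a self-shrinking surface \<open>\<Delta>|\<phi>|\<^sup>2 = 2 (2 - |H|\<^sup>2)\<close>, so each of the three hypotheses makes \<open>|\<phi>|\<^sup>2\<close>
  sub- or superharmonic; by Hopf's strong maximum principle it is constant, hence \<open>|\<phi>|\<^sup>2 = 2\<close> and \<open>H = -\<phi>\<close>.
  Let \<open>E\<close> be the phase of the complex determinant of a tangent frame (the Lagrangian angle) and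
  \<open>\<theta> = \<langle>J\<phi>, d\<phi>\<rangle>\<close>. The total symmetry of \<open>\<langle>\<sigma>(\<cdot>,\<cdot>), J\<cdot>\<rangle>\<close> together with \<open>H = -\<phi>\<close> gives \<open>dE = i \<theta> E\<close>.
  Writing \<open>\<phi> = (z, w)\<close>, this makes \<open>p = cnj E z\<^sup>2 - E (cnj w)\<^sup>2\<close> and \<open>r = Re (cnj E z w)\<close> locally constant, and
  \<open>r (|w|\<^sup>2 - |z|\<^sup>2) + Re (p (cnj z) w) = 0\<close>: the Hopf projection of \<open>\<phi>\<close> stays on a fixed great circle,
  whose preimage is a unitary image of the Clifford torus. The image is compact and,
  by the open mapping property of immersions, open in that torus, hence all of it.
\<close>

text \<open>Why such invariants exist: a Lagrangian surface whose position vector is normal has J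
  phi as a tangent field, so it is a union of Hopf circles over a curve in the 2-sphere. On the
  3-sphere of radius sqrt 2, H = -phi says that the surface is minimal in that sphere, which makes
  the curve a geodesic; (p, r) encodes the pole of this great circle. Its constancy is a first-order
  computation once dE is known, and no curvature or genus argument enters.

  The obstacle is globalisation. E belongs to a coordinate frame: reversing the orientation of the
  frame replaces E by -E and (p, r) by (-p, -r), and orientability of M is not known in advance. So
  it is not (p, r) that is carried across M but the relation it satisfies, which does not see the
  sign. This works because the relation is rigid: holding on a nonempty open piece of a chart, it
  determines (p, r) up to sign there.

  The number 2 is the trace of the metric, that is, the dimension of M, and thereby the squared
  radius of the sphere.\<close>

section \<open>Symmetry of second derivatives\<close>

lemma DERIV_along_line:
  fixes g :: "'a::real_normed_vector \<Rightarrow> real"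
  assumes "(g has_derivative G) (at (q + t *\<^sub>R a))"
  shows "((\<lambda>t. g (q + t *\<^sub>R a)) has_real_derivative G a) (at t)"
proof -
  have "((\<lambda>t. q + t *\<^sub>R a) has_derivative (\<lambda>h. h *\<^sub>R a)) (at t)"
    by (auto intro!: derivative_eq_intros)
  from diff_chain_at[OF this assms]
  have "((\<lambda>t. g (q + t *\<^sub>R a)) has_derivative (\<lambda>h. G (h *\<^sub>R a))) (at t)"
    by (simp add: o_def)
  moreover have "(\<lambda>h. G (h *\<^sub>R a)) = (*) (G a)"
    using has_derivative_linear[OF assms] by (auto simp: linear_cmul fun_eq_iff)
  ultimately show ?thesis
    unfolding has_field_derivative_def by simp
qed

text \<open>The mean value theorem is applied twice: to the increment of \<open>g\<close> by
  \<open>s *\<^sub>R b\<close>, as a function along \<open>a\<close>, and then to the derivative in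
  direction \<open>a\<close>, along \<open>b\<close>. The second difference is symmetric in
  \<open>a\<close> and \<open>b\<close>, the expression found for it is not; the next lemma exploits
  this.\<close>

lemma second_difference_mvt:
  fixes g :: "'a::real_normed_vector \<Rightarrow> real"
  assumes dg: "\<And>p. p \<in> ball u r \<Longrightarrow> (g has_derivative G p) (at p)"
    and dga: "\<And>p. p \<in> ball u r \<Longrightarrow> ((\<lambda>p. G p a) has_derivative A p) (at p)"
    and s: "0 < s" "s * (norm a + norm b) < r"
  shows "\<exists>p\<in>cball u (s * (norm a + norm b)).
    g (u + s *\<^sub>R a + s *\<^sub>R b) - g (u + s *\<^sub>R a) - g (u + s *\<^sub>R b) + g u = s\<^sup>2 * A p b"
proof -
  have near: "u + t *\<^sub>R a + t' *\<^sub>R b \<in> cball u (s * (norm a + norm b))"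
    if "0 \<le> t" "t \<le> s" "0 \<le> t'" "t' \<le> s" for t t'
  proof -
    have "norm (t *\<^sub>R a + t' *\<^sub>R b) \<le> t * norm a + t' * norm b"
      using norm_triangle_ineq[of "t *\<^sub>R a" "t' *\<^sub>R b"] that by simp
    also have "\<dots> \<le> s * norm a + s * norm b"
      using that by (intro add_mono mult_right_mono) auto
    finally show ?thesis
      by (simp add: dist_norm norm_minus_commute algebra_simps)
  qed
  have nearb: "u + t *\<^sub>R a + t' *\<^sub>R b \<in> ball u r"
    if "0 \<le> t" "t \<le> s" "0 \<le> t'" "t' \<le> s" for t t'
    using near[OF that] s(2) by auto
  have "((\<lambda>t. g (u + s *\<^sub>R b + t *\<^sub>R a) - g (u + t *\<^sub>R a)) has_real_derivative
       (G (u + s *\<^sub>R b + t *\<^sub>R a) a - G (u + t *\<^sub>R a) a)) (at t)" if "0 \<le> t" "t \<le> s" for t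
    using that s nearb[of t s] nearb[of t 0]
    by (intro DERIV_diff DERIV_along_line dg) (auto simp: algebra_simps)
  from MVT2[OF s(1) this] obtain z where z: "0 < z" "z < s"
    and 1: "(g (u + s *\<^sub>R b + s *\<^sub>R a) - g (u + s *\<^sub>R a)) - (g (u + s *\<^sub>R b + 0 *\<^sub>R a) - g (u + 0 *\<^sub>R a))
        = (s - 0) * (G (u + s *\<^sub>R b + z *\<^sub>R a) a - G (u + z *\<^sub>R a) a)"
    by blast
  have "((\<lambda>t. G (u + z *\<^sub>R a + t *\<^sub>R b) a) has_real_derivative A (u + z *\<^sub>R a + t *\<^sub>R b) b) (at t)"
    if "0 \<le> t" "t \<le> s" for t
    using that z nearb[of z t] by (intro DERIV_along_line[where g = "\<lambda>p. G p a"] dga) auto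
  from MVT2[OF s(1) this] obtain y where y: "0 < y" "y < s"
    and 2: "G (u + z *\<^sub>R a + s *\<^sub>R b) a - G (u + z *\<^sub>R a + 0 *\<^sub>R b) a
        = (s - 0) * A (u + z *\<^sub>R a + y *\<^sub>R b) b"
    by blast
  show ?thesis
  proof (rule bexI)
    show "u + z *\<^sub>R a + y *\<^sub>R b \<in> cball u (s * (norm a + norm b))"
      using near[of z y] z y by auto
    show "g (u + s *\<^sub>R a + s *\<^sub>R b) - g (u + s *\<^sub>R a) - g (u + s *\<^sub>R b) + g u
        = s\<^sup>2 * A (u + z *\<^sub>R a + y *\<^sub>R b) b"
      using 1 2 by (simp add: power2_eq_square add_ac)
  qed
qed

text \<open>Both orders of differentiation evaluate the same second difference, so
  \<open>A p b = B q a\<close> for points \<open>p\<close>, \<open>q\<close> arbitrarily close to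
  \<open>u\<close>; continuity then excludes a gap at \<open>u\<close>.\<close>

lemma mixed_second_derivatives_eq:
  fixes g :: "'a::real_normed_vector \<Rightarrow> real"
  assumes V: "open V" "u \<in> V"
    and dg: "\<And>p. p \<in> V \<Longrightarrow> (g has_derivative G p) (at p)"
    and dga: "\<And>p. p \<in> V \<Longrightarrow> ((\<lambda>p. G p a) has_derivative A p) (at p)"
    and dgb: "\<And>p. p \<in> V \<Longrightarrow> ((\<lambda>p. G p b) has_derivative B p) (at p)"
    and cont: "continuous_on V (\<lambda>p. A p b)" "continuous_on V (\<lambda>p. B p a)"
  shows "A u b = B u a"
proof (rule ccontr)
  assume neq: "A u b \<noteq> B u a"
  define e where "e = \<bar>A u b - B u a\<bar> / 2"
  have e: "e > 0" using neq by (simp add: e_def)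
  have "\<forall>\<^sub>F p in at u. dist (A p b) (A u b) < e" "\<forall>\<^sub>F p in at u. dist (B p a) (B u a) < e"
    using cont V e by (auto simp: continuous_on_eq_continuous_at isCont_def tendsto_iff)
  then obtain d1 d2 where d: "d1 > 0" "d2 > 0"
    "\<And>p. p \<noteq> u \<Longrightarrow> dist p u < d1 \<Longrightarrow> dist (A p b) (A u b) < e"
    "\<And>p. p \<noteq> u \<Longrightarrow> dist p u < d2 \<Longrightarrow> dist (B p a) (B u a) < e"
    unfolding eventually_at by blast
  obtain r0 where r0: "r0 > 0" "ball u r0 \<subseteq> V"
    using V open_contains_ball by blast
  define r where "r = min r0 (min d1 d2)"
  \<comment> \<open>The summand 1 keeps the divisor positive even if both directions vanish.\<close>
  define N where "N = norm a + norm b + 1"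
  define s where "s = r / (2 * N)"
  have N: "N > 0" by (simp add: N_def add_nonneg_pos)
  have r: "r > 0" using r0 d by (simp add: r_def)
  then have s: "s > 0" using N by (simp add: s_def)
  have "s * (norm a + norm b) < s * N" using s by (simp add: N_def)
  also have "\<dots> = r / 2" using N by (simp add: s_def)
  finally have sr: "s * (norm a + norm b) < r" using r by simp
  have in_V: "p \<in> V" if "p \<in> ball u r" for p
    using that r0 by (auto simp: r_def)
  obtain p where p: "p \<in> cball u (s * (norm a + norm b))"
    "g (u + s *\<^sub>R a + s *\<^sub>R b) - g (u + s *\<^sub>R a) - g (u + s *\<^sub>R b) + g u = s\<^sup>2 * A p b"
    using second_difference_mvt[of u r g G a A s b] dg dga in_V s sr by blast
  have "s * (norm b + norm a) < r" using sr by (simp add: add.commute)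
  then obtain q where q: "q \<in> cball u (s * (norm b + norm a))"
    "g (u + s *\<^sub>R b + s *\<^sub>R a) - g (u + s *\<^sub>R b) - g (u + s *\<^sub>R a) + g u = s\<^sup>2 * B q a"
    using second_difference_mvt[of u r g G b B s a] dg dgb in_V s by blast
  have "s\<^sup>2 * A p b = s\<^sup>2 * B q a"
    using p(2) q(2) by (simp add: algebra_simps)
  then have "A p b = B q a" using s by simp
  moreover have "dist (A p b) (A u b) < e" "dist (B q a) (B u a) < e"
    using d(3)[of p] d(4)[of q] p(1) q(1) sr e
    by (cases "p = u"; cases "q = u"; simp add: dist_commute r_def add.commute[of "norm b"])+
  ultimately show False
    by (simp add: e_def dist_real_def abs_if split: if_splits)
qed

lemma has_derivative_dirD:
  assumes "f differentiable (at p)"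
  shows "(f has_derivative (\<lambda>h. dirD f h p)) (at p)"
  unfolding dirD_def using assms by (rule frechet_derivative_works[THEN iffD1])

lemma Ck_on_2_D:
  assumes "open V" "Ck_on 2 f V"
  shows "\<And>p. p \<in> V \<Longrightarrow> f differentiable (at p)"
    and "\<And>p e. p \<in> V \<Longrightarrow> dirD f e differentiable (at p)"
    and "\<And>e e'. continuous_on V (dirD (dirD f e) e')"
proof -
  have "Ck_on (Suc (Suc 0)) f V"
    using assms(2) by (metis numeral_2_eq_2)
  then have *: "f differentiable_on V" "dirD f e differentiable_on V" "continuous_on V (dirD (dirD f e) e')" for e e'
    by simp_all
  show "f differentiable (at p)" if "p \<in> V" for p
    using *(1) that assms(1) by (simp add: differentiable_on_eq_differentiable_at)
  show "dirD f e differentiable (at p)" if "p \<in> V" for p e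
    using *(2) that assms(1) by (simp add: differentiable_on_eq_differentiable_at)
  show "continuous_on V (dirD (dirD f e) e')" for e e'
    by (rule *(3))
qed

text \<open>The mean value argument is scalar, hence the passage to components along basis vectors
  \<open>c\<close>.\<close>

lemma dirD_commute:
  assumes V: "open V" "u \<in> V" and f: "Ck_on 2 f V"
  shows "dirD (dirD f a) b u = dirD (dirD f b) a u"
proof (rule euclidean_eqI)
  fix c :: 'b
  note d1 = Ck_on_2_D(1)[OF V(1) f] and d2 = Ck_on_2_D(2)[OF V(1) f] and c2 = Ck_on_2_D(3)[OF V(1) f]
  show "dirD (dirD f a) b u \<bullet> c = dirD (dirD f b) a u \<bullet> c"
  proof (rule mixed_second_derivatives_eq[OF V, where g = "\<lambda>p. f p \<bullet> c" and G = "\<lambda>p h. dirD f h p \<bullet> c"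
        and A = "\<lambda>p h. dirD (dirD f a) h p \<bullet> c" and B = "\<lambda>p h. dirD (dirD f b) h p \<bullet> c"])
    show "((\<lambda>p. f p \<bullet> c) has_derivative (\<lambda>h. dirD f h p \<bullet> c)) (at p)" if "p \<in> V" for p
      using has_derivative_dirD[OF d1[OF that]] by (rule has_derivative_inner_left)
    show "((\<lambda>p. dirD f a p \<bullet> c) has_derivative (\<lambda>h. dirD (dirD f a) h p \<bullet> c)) (at p)" if "p \<in> V" for p
      using has_derivative_dirD[OF d2[OF that]] by (rule has_derivative_inner_left)
    show "((\<lambda>p. dirD f b p \<bullet> c) has_derivative (\<lambda>h. dirD (dirD f b) h p \<bullet> c)) (at p)" if "p \<in> V" for p
      using has_derivative_dirD[OF d2[OF that]] by (rule has_derivative_inner_left)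
    show "continuous_on V (\<lambda>p. dirD (dirD f a) b p \<bullet> c)" "continuous_on V (\<lambda>p. dirD (dirD f b) a p \<bullet> c)"
      using c2 by (auto intro!: continuous_on_inner continuous_on_const)
  qed
qed

section \<open>The strong maximum principle in the plane\<close>

text \<open>One field serves as the mixed entry for both first derivatives: symmetry of the Hessian
  is built into the notion, and charts obtain it from \<open>dirD_commute\<close>.\<close>

definition has_jet2 :: "(real^2) set \<Rightarrow> (real^2 \<Rightarrow> 'b::real_normed_vector) \<Rightarrow> (real^2 \<Rightarrow> 'b) \<Rightarrow> (real^2 \<Rightarrow> 'b) \<Rightarrow>
    (real^2 \<Rightarrow> 'b) \<Rightarrow> (real^2 \<Rightarrow> 'b) \<Rightarrow> (real^2 \<Rightarrow> 'b) \<Rightarrow> bool" where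
  "has_jet2 V f f\<^sub>1 f\<^sub>2 f\<^sub>1\<^sub>1 f\<^sub>1\<^sub>2 f\<^sub>2\<^sub>2 \<longleftrightarrow> (\<forall>u\<in>V.
     (f has_derivative (\<lambda>h. (h$1) *\<^sub>R f\<^sub>1 u + (h$2) *\<^sub>R f\<^sub>2 u)) (at u) \<and>
     (f\<^sub>1 has_derivative (\<lambda>h. (h$1) *\<^sub>R f\<^sub>1\<^sub>1 u + (h$2) *\<^sub>R f\<^sub>1\<^sub>2 u)) (at u) \<and>
     (f\<^sub>2 has_derivative (\<lambda>h. (h$1) *\<^sub>R f\<^sub>1\<^sub>2 u + (h$2) *\<^sub>R f\<^sub>2\<^sub>2 u)) (at u))"

lemma has_jet2D:
  assumes "has_jet2 V f f\<^sub>1 f\<^sub>2 f\<^sub>1\<^sub>1 f\<^sub>1\<^sub>2 f\<^sub>2\<^sub>2" "u \<in> V"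
  shows "(f has_derivative (\<lambda>h. (h$1) *\<^sub>R f\<^sub>1 u + (h$2) *\<^sub>R f\<^sub>2 u)) (at u)"
    and "(f\<^sub>1 has_derivative (\<lambda>h. (h$1) *\<^sub>R f\<^sub>1\<^sub>1 u + (h$2) *\<^sub>R f\<^sub>1\<^sub>2 u)) (at u)"
    and "(f\<^sub>2 has_derivative (\<lambda>h. (h$1) *\<^sub>R f\<^sub>1\<^sub>2 u + (h$2) *\<^sub>R f\<^sub>2\<^sub>2 u)) (at u)"
  using assms unfolding has_jet2_def by auto

lemma has_jet2_add_scaled:
  fixes f g :: "real^2 \<Rightarrow> real"
  assumes "has_jet2 V f f\<^sub>1 f\<^sub>2 f\<^sub>1\<^sub>1 f\<^sub>1\<^sub>2 f\<^sub>2\<^sub>2" "has_jet2 V g g\<^sub>1 g\<^sub>2 g\<^sub>1\<^sub>1 g\<^sub>1\<^sub>2 g\<^sub>2\<^sub>2"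
  shows "has_jet2 V (\<lambda>u. f u + c * g u) (\<lambda>u. f\<^sub>1 u + c * g\<^sub>1 u) (\<lambda>u. f\<^sub>2 u + c * g\<^sub>2 u)
    (\<lambda>u. f\<^sub>1\<^sub>1 u + c * g\<^sub>1\<^sub>1 u) (\<lambda>u. f\<^sub>1\<^sub>2 u + c * g\<^sub>1\<^sub>2 u) (\<lambda>u. f\<^sub>2\<^sub>2 u + c * g\<^sub>2\<^sub>2 u)"
  unfolding has_jet2_def
proof (intro ballI conjI)
  fix u assume u: "u \<in> V"
  note d = has_jet2D[OF assms(1) u] has_jet2D[OF assms(2) u]
  show "((\<lambda>u. f u + c * g u) has_derivative (\<lambda>h. h $ 1 *\<^sub>R (f\<^sub>1 u + c * g\<^sub>1 u) + h $ 2 *\<^sub>R (f\<^sub>2 u + c * g\<^sub>2 u))) (at u)"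
    by (rule has_derivative_eq_rhs, rule has_derivative_add, rule d, rule has_derivative_mult_right, rule d)
      (auto simp: algebra_simps)
  show "((\<lambda>u. f\<^sub>1 u + c * g\<^sub>1 u) has_derivative (\<lambda>h. h $ 1 *\<^sub>R (f\<^sub>1\<^sub>1 u + c * g\<^sub>1\<^sub>1 u) + h $ 2 *\<^sub>R (f\<^sub>1\<^sub>2 u + c * g\<^sub>1\<^sub>2 u))) (at u)"
    by (rule has_derivative_eq_rhs, rule has_derivative_add, rule d, rule has_derivative_mult_right, rule d)
      (auto simp: algebra_simps)
  show "((\<lambda>u. f\<^sub>2 u + c * g\<^sub>2 u) has_derivative (\<lambda>h. h $ 1 *\<^sub>R (f\<^sub>1\<^sub>2 u + c * g\<^sub>1\<^sub>2 u) + h $ 2 *\<^sub>R (f\<^sub>2\<^sub>2 u + c * g\<^sub>2\<^sub>2 u))) (at u)"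
    by (rule has_derivative_eq_rhs, rule has_derivative_add, rule d, rule has_derivative_mult_right, rule d)
      (auto simp: algebra_simps)
qed

text \<open>A one-variable test along the line through \<open>z\<close> in direction
  \<open>v\<close>. Instead of a Taylor expansion: if \<open>g''\<close> were positive,
  \<open>g'\<close> would be positive just to the right of 0, and the mean value theorem would lift
  \<open>w\<close> above its maximum.\<close>

lemma local_max_second_derivative:
  fixes w :: "real^2 \<Rightarrow> real"
  assumes jet: "has_jet2 V w w\<^sub>1 w\<^sub>2 w\<^sub>1\<^sub>1 w\<^sub>1\<^sub>2 w\<^sub>2\<^sub>2"
    and r: "r > 0" "ball z r \<subseteq> V" and max: "\<And>u. u \<in> ball z r \<Longrightarrow> w u \<le> w z"
  shows "v\<^sub>1 * w\<^sub>1 z + v\<^sub>2 * w\<^sub>2 z = 0"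
    and "v\<^sub>1\<^sup>2 * w\<^sub>1\<^sub>1 z + 2 * v\<^sub>1 * v\<^sub>2 * w\<^sub>1\<^sub>2 z + v\<^sub>2\<^sup>2 * w\<^sub>2\<^sub>2 z \<le> 0"
proof -
  define v :: "real^2" where "v = vector [v\<^sub>1, v\<^sub>2]"
  define N where "N = norm v + 1"
  define \<delta> where "\<delta> = r / N"
  have N: "N > 0" by (simp add: N_def add_nonneg_pos)
  have \<delta>: "\<delta> > 0" using N r by (simp add: \<delta>_def)
  have in_ball: "z + t *\<^sub>R v \<in> ball z r" if "\<bar>t\<bar> < \<delta>" for t
  proof -
    have "\<bar>t\<bar> * norm v \<le> \<bar>t\<bar> * N" by (simp add: N_def mult_left_mono)
    also have "\<dots> < \<delta> * N" using that N by simp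
    also have "\<dots> = r" using N by (simp add: \<delta>_def)
    finally show ?thesis by (simp add: dist_norm)
  qed
  define g' where "g' t = v\<^sub>1 * w\<^sub>1 (z + t *\<^sub>R v) + v\<^sub>2 * w\<^sub>2 (z + t *\<^sub>R v)" for t
  define g'' where "g'' = v\<^sub>1\<^sup>2 * w\<^sub>1\<^sub>1 z + 2 * v\<^sub>1 * v\<^sub>2 * w\<^sub>1\<^sub>2 z + v\<^sub>2\<^sup>2 * w\<^sub>2\<^sub>2 z"
  have dg: "((\<lambda>t. w (z + t *\<^sub>R v)) has_real_derivative g' t) (at t)" if "\<bar>t\<bar> < \<delta>" for t
    using DERIV_along_line[OF has_jet2D(1)[OF jet], of z t v] in_ball[OF that] r
    by (auto simp: g'_def v_def vector_2)
  have zV: "z + 0 *\<^sub>R v \<in> V" using r by auto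
  have dg': "(g' has_real_derivative g'') (at 0)"
    unfolding g'_def
    by (rule DERIV_cong, rule DERIV_add, rule DERIV_cmult, rule DERIV_along_line, rule has_jet2D(2)[OF jet zV],
        rule DERIV_cmult, rule DERIV_along_line, rule has_jet2D(3)[OF jet zV])
      (simp add: g''_def v_def vector_2 power2_eq_square algebra_simps)
  have mx: "w (z + t *\<^sub>R v) \<le> w (z + 0 *\<^sub>R v)" if "\<bar>t\<bar> < \<delta>" for t
    using max[OF in_ball[OF that]] by simp
  have g'0: "g' 0 = 0"
    using DERIV_local_max[OF dg[of 0] \<delta>] mx \<delta> by auto
  then show "v\<^sub>1 * w\<^sub>1 z + v\<^sub>2 * w\<^sub>2 z = 0"
    by (simp add: g'_def)
  have "g'' \<le> 0"
  proof (rule ccontr)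
    assume "\<not> g'' \<le> 0"
    then obtain d where d: "d > 0" "\<And>h. h > 0 \<Longrightarrow> h < d \<Longrightarrow> g' 0 < g' (0 + h)"
      using DERIV_pos_inc_right[OF dg'] by auto
    define t where "t = min d \<delta> / 2"
    have t: "0 < t" "t < d" "t < \<delta>" using d \<delta> by (auto simp: t_def)
    have "\<exists>\<xi>>0. \<xi> < t \<and> w (z + t *\<^sub>R v) - w (z + 0 *\<^sub>R v) = (t - 0) * g' \<xi>"
      by (rule MVT2[OF t(1)]) (use dg t in auto)
    then obtain \<xi> where \<xi>: "0 < \<xi>" "\<xi> < t" "w (z + t *\<^sub>R v) - w (z + 0 *\<^sub>R v) = (t - 0) * g' \<xi>"
      by blast
    have "g' \<xi> > 0" using d(2)[of \<xi>] \<xi> t g'0 by simp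
    then have "w (z + t *\<^sub>R v) - w (z + 0 *\<^sub>R v) > 0" unfolding \<xi>(3) using t by simp
    then show False using mx[of t] t by simp
  qed
  then show "v\<^sub>1\<^sup>2 * w\<^sub>1\<^sub>1 z + 2 * v\<^sub>1 * v\<^sub>2 * w\<^sub>1\<^sub>2 z + v\<^sub>2\<^sup>2 * w\<^sub>2\<^sub>2 z \<le> 0"
    by (simp add: g''_def)
qed

text \<open>Replaces diagonalisation: with q the Hessian form, a11 times the second-order part
  equals q(a11, a12) + (a11 a22 - a12^2) w22, and both summands are nonpositive at a maximum. The
  first-order part vanishes there.\<close>

lemma local_max_elliptic_le_0:
  fixes w :: "real^2 \<Rightarrow> real"
  assumes jet: "has_jet2 V w w\<^sub>1 w\<^sub>2 w\<^sub>1\<^sub>1 w\<^sub>1\<^sub>2 w\<^sub>2\<^sub>2"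
    and r: "r > 0" "ball z r \<subseteq> V" and max: "\<And>u. u \<in> ball z r \<Longrightarrow> w u \<le> w z"
    and a: "a\<^sub>1\<^sub>1 > 0" "a\<^sub>1\<^sub>1 * a\<^sub>2\<^sub>2 - a\<^sub>1\<^sub>2\<^sup>2 > 0"
  shows "a\<^sub>1\<^sub>1 * w\<^sub>1\<^sub>1 z + 2 * a\<^sub>1\<^sub>2 * w\<^sub>1\<^sub>2 z + a\<^sub>2\<^sub>2 * w\<^sub>2\<^sub>2 z + b\<^sub>1 * w\<^sub>1 z + b\<^sub>2 * w\<^sub>2 z \<le> 0"
proof -
  note D1 = local_max_second_derivative(1)[OF jet r max]
  note D2 = local_max_second_derivative(2)[OF jet r max]
  have 1: "b\<^sub>1 * w\<^sub>1 z + b\<^sub>2 * w\<^sub>2 z = 0" by (rule D1)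
  have 2: "a\<^sub>1\<^sub>1\<^sup>2 * w\<^sub>1\<^sub>1 z + 2 * a\<^sub>1\<^sub>1 * a\<^sub>1\<^sub>2 * w\<^sub>1\<^sub>2 z + a\<^sub>1\<^sub>2\<^sup>2 * w\<^sub>2\<^sub>2 z \<le> 0" by (rule D2)
  have 3: "w\<^sub>2\<^sub>2 z \<le> 0" using D2[of 0 1] by simp
  have "(a\<^sub>1\<^sub>1 * a\<^sub>2\<^sub>2 - a\<^sub>1\<^sub>2\<^sup>2) * w\<^sub>2\<^sub>2 z \<le> 0"
    using a 3 by (simp add: mult_nonneg_nonpos)
  with 2 have "a\<^sub>1\<^sub>1 * (a\<^sub>1\<^sub>1 * w\<^sub>1\<^sub>1 z + 2 * a\<^sub>1\<^sub>2 * w\<^sub>1\<^sub>2 z + a\<^sub>2\<^sub>2 * w\<^sub>2\<^sub>2 z) \<le> 0"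
    by (simp add: algebra_simps power2_eq_square)
  then have "a\<^sub>1\<^sub>1 * w\<^sub>1\<^sub>1 z + 2 * a\<^sub>1\<^sub>2 * w\<^sub>1\<^sub>2 z + a\<^sub>2\<^sub>2 * w\<^sub>2\<^sub>2 z \<le> 0"
    using a(1) by (simp add: mult_le_0_iff)
  then show ?thesis using 1 by linarith
qed

lemma has_jet2_gaussian:
  fixes c :: "real^2" and \<alpha> :: real
  defines "h \<equiv> \<lambda>u. exp (- \<alpha> * ((u$1 - c$1)\<^sup>2 + (u$2 - c$2)\<^sup>2))"
  shows "has_jet2 V (\<lambda>u. h u - k) (\<lambda>u. - 2 * \<alpha> * (u$1 - c$1) * h u) (\<lambda>u. - 2 * \<alpha> * (u$2 - c$2) * h u)
    (\<lambda>u. (4 * \<alpha>\<^sup>2 * (u$1 - c$1)\<^sup>2 - 2 * \<alpha>) * h u)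
    (\<lambda>u. 4 * \<alpha>\<^sup>2 * (u$1 - c$1) * (u$2 - c$2) * h u)
    (\<lambda>u. (4 * \<alpha>\<^sup>2 * (u$2 - c$2)\<^sup>2 - 2 * \<alpha>) * h u)"
proof -
  have dn: "((\<lambda>u::real^2. u $ i) has_derivative (\<lambda>h. h $ i)) (at u)" for u i
    by (rule bounded_linear_imp_has_derivative) (rule bounded_linear_vec_nth)
  have dh: "(h has_derivative (\<lambda>v. - 2 * \<alpha> * ((u$1 - c$1) * v$1 + (u$2 - c$2) * v$2) * h u)) (at u)" for u
    unfolding h_def
    by (auto intro!: derivative_eq_intros dn simp: fun_eq_iff algebra_simps)
  show ?thesis
    unfolding has_jet2_def
    by (auto intro!: derivative_eq_intros dn dh simp: fun_eq_iff algebra_simps power2_eq_square)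
qed

lemma dist_squared_real2: "(dist u c)\<^sup>2 = (u$1 - c$1)\<^sup>2 + (u$2 - c$2)\<^sup>2" for u c :: "real^2"
  unfolding dist_norm power2_norm_eq_inner by (simp add: inner_vec_def sum_2 power2_eq_square)

text \<open>
  Perturbing \<open>w\<close> by a small multiple of a Gaussian centred at \<open>c\<close>, which is strictly subharmonic near \<open>y\<close>
  for large \<open>\<alpha>\<close>, would produce an interior maximum.
\<close>

lemma no_touching_ball:
  fixes w :: "real^2 \<Rightarrow> real"
  assumes V: "open V" and jet: "has_jet2 V w w\<^sub>1 w\<^sub>2 w\<^sub>1\<^sub>1 w\<^sub>1\<^sub>2 w\<^sub>2\<^sub>2"
    and cont: "continuous_on V a\<^sub>1\<^sub>1" "continuous_on V a\<^sub>1\<^sub>2" "continuous_on V a\<^sub>2\<^sub>2"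
      "continuous_on V b\<^sub>1" "continuous_on V b\<^sub>2"
    and ell: "\<And>u. u \<in> V \<Longrightarrow> a\<^sub>1\<^sub>1 u > 0" "\<And>u. u \<in> V \<Longrightarrow> a\<^sub>1\<^sub>1 u * a\<^sub>2\<^sub>2 u - (a\<^sub>1\<^sub>2 u)\<^sup>2 > 0"
    and sub: "\<And>u. u \<in> V \<Longrightarrow>
      0 \<le> a\<^sub>1\<^sub>1 u * w\<^sub>1\<^sub>1 u + 2 * a\<^sub>1\<^sub>2 u * w\<^sub>1\<^sub>2 u + a\<^sub>2\<^sub>2 u * w\<^sub>2\<^sub>2 u + b\<^sub>1 u * w\<^sub>1 u + b\<^sub>2 u * w\<^sub>2 u"
    and le: "\<And>u. u \<in> V \<Longrightarrow> w u \<le> m"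
    and y: "y \<in> V" "w y = m" and R: "R > 0" "dist y c = R"
    and less: "\<And>u. u \<in> V \<Longrightarrow> u \<in> cball c R \<Longrightarrow> u \<noteq> y \<Longrightarrow> w u < m"
  shows False
proof -
  obtain s0 where s0: "s0 > 0" "cball y s0 \<subseteq> V"
    using V y open_contains_cball by blast
  \<comment> \<open>A radius below \<open>R\<close> keeps the centre \<open>c\<close> out of the
    small ball, which makes \<open>Q\<close> positive on it.\<close>
  define s where "s = min s0 (R/2)"
  have s: "s > 0" "s < R" "cball y s \<subseteq> V"
    using s0 R by (auto simp: s_def)
  let ?K = "cball y s"
  have Kne: "?K \<noteq> {}" using s by auto
  have contw: "continuous_on V w"
    using has_jet2D(1)[OF jet] by (meson continuous_at_imp_continuous_on has_derivative_continuous)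
  \<comment> \<open>The elliptic operator sends the Gaussian \<open>h\<close> to
    \<open>h * (4 * \<alpha>\<^sup>2 * Q - 2 * \<alpha> * T)\<close>.\<close>
  define Q where "Q u = a\<^sub>1\<^sub>1 u * (u$1 - c$1)\<^sup>2 + 2 * a\<^sub>1\<^sub>2 u * (u$1 - c$1) * (u$2 - c$2) + a\<^sub>2\<^sub>2 u * (u$2 - c$2)\<^sup>2" for u
  define T where "T u = a\<^sub>1\<^sub>1 u + a\<^sub>2\<^sub>2 u + b\<^sub>1 u * (u$1 - c$1) + b\<^sub>2 u * (u$2 - c$2)" for u
  have "continuous_on ?K Q" "continuous_on ?K T"
    unfolding Q_def T_def
    by (intro continuous_intros continuous_on_subset[OF cont(1) s(3)] continuous_on_subset[OF cont(2) s(3)]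
        continuous_on_subset[OF cont(3) s(3)] continuous_on_subset[OF cont(4) s(3)]
        continuous_on_subset[OF cont(5) s(3)])+
  then obtain uq ut where uq: "uq \<in> ?K" "\<And>u. u \<in> ?K \<Longrightarrow> Q uq \<le> Q u"
    and ut: "ut \<in> ?K" "\<And>u. u \<in> ?K \<Longrightarrow> T u \<le> T ut"
    using continuous_attains_inf[of ?K Q] continuous_attains_sup[of ?K T] Kne by auto
  have Qpos: "Q u > 0" if "u \<in> ?K" for u
  proof -
    have uV: "u \<in> V" using that s by auto
    have "u \<noteq> c" using that s R by (auto simp: dist_commute)
    then have ne: "u$1 - c$1 \<noteq> 0 \<or> u$2 - c$2 \<noteq> 0"
      by (auto simp: vec_eq_iff forall_2)
    have eq: "a\<^sub>1\<^sub>1 u * Q u = (a\<^sub>1\<^sub>1 u * (u$1 - c$1) + a\<^sub>1\<^sub>2 u * (u$2 - c$2))\<^sup>2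
        + (a\<^sub>1\<^sub>1 u * a\<^sub>2\<^sub>2 u - (a\<^sub>1\<^sub>2 u)\<^sup>2) * (u$2 - c$2)\<^sup>2"
      by (simp add: Q_def power2_eq_square algebra_simps)
    have "a\<^sub>1\<^sub>1 u * Q u > 0"
    proof (cases "u$2 - c$2 = 0")
      case True
      then show ?thesis using eq ne ell(1)[OF uV] by simp
    next
      case False
      then show ?thesis using eq ell(2)[OF uV]
        by (simp add: add_nonneg_pos)
    qed
    then show ?thesis using ell(1)[OF uV] by (simp add: zero_less_mult_iff)
  qed
  define q where "q = Q uq"
  have q: "q > 0" "\<And>u. u \<in> ?K \<Longrightarrow> q \<le> Q u" using uq Qpos by (auto simp: q_def)
  \<comment> \<open>With this choice \<open>\<alpha> * q\<close> exceeds every value of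
    \<open>T\<close> on the small ball, so the Gaussian is strictly subharmonic there.\<close>
  define \<alpha> where "\<alpha> = (\<bar>T ut\<bar> + 1) / q"
  have \<alpha>: "\<alpha> > 0" using q by (simp add: \<alpha>_def add_nonneg_pos)
  have \<alpha>Q: "4 * \<alpha>\<^sup>2 * Q u - 2 * \<alpha> * T u > 0" if "u \<in> ?K" for u
  proof -
    have "\<alpha> * q = \<bar>T ut\<bar> + 1" using q by (simp add: \<alpha>_def)
    then have "T u < \<alpha> * q" using ut(2)[OF that] by linarith
    also have "\<dots> \<le> \<alpha> * Q u" using q(2)[OF that] \<alpha> by simp
    finally have "T u < 2 * (\<alpha> * Q u)" using \<alpha> Qpos[OF that] mult_pos_pos[of \<alpha> "Q u"] by linarith
    then have "0 < (2 * \<alpha>) * (2 * (\<alpha> * Q u) - T u)" using \<alpha> by simp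
    then show ?thesis by (simp add: power2_eq_square algebra_simps)
  qed
  define h where "h u = exp (- \<alpha> * ((u$1 - c$1)\<^sup>2 + (u$2 - c$2)\<^sup>2))" for u :: "real^2"
  define k where "k = exp (- \<alpha> * R\<^sup>2)"
  have h_le: "h u \<le> 1" for u using \<alpha> by (simp add: h_def)
  have hy: "h y = k" using R by (simp add: h_def k_def flip: dist_squared_real2)
  have h_out: "h u < k" if "dist u c > R" for u
  proof -
    have "R\<^sup>2 < (dist u c)\<^sup>2" using that R by (simp add: power_strict_mono)
    then show ?thesis using \<alpha> by (simp add: h_def k_def flip: dist_squared_real2)
  qed
  \<comment> \<open>A gap is required only on the part of the small sphere inside the closed ball
    about \<open>c\<close>; outside, the Gaussian has dropped below \<open>k\<close>. Since
    \<open>h - k < 1\<close>, the perturbation by half the gap cannot close it.\<close>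
  have "\<exists>\<eta>>0. \<forall>u\<in>sphere y s \<inter> cball c R. w u \<le> m - \<eta>"
  proof (cases "sphere y s \<inter> cball c R = {}")
    case True
    then show ?thesis by (intro exI[of _ 1]) auto
  next
    case False
    have sub': "sphere y s \<inter> cball c R \<subseteq> V" using s by auto
    obtain u1 where u1: "u1 \<in> sphere y s \<inter> cball c R" "\<forall>u\<in>sphere y s \<inter> cball c R. w u \<le> w u1"
      using continuous_attains_sup[OF _ False continuous_on_subset[OF contw sub']] compact_Int[OF compact_sphere compact_cball]
      by blast
    have "u1 \<noteq> y" using u1 s by auto
    then have "w u1 < m" using less[of u1] u1 sub' by auto
    then show ?thesis using u1 by (intro exI[of _ "m - w u1"]) auto
  qed
  then obtain \<eta> where \<eta>: "\<eta> > 0" "\<And>u. u \<in> sphere y s \<Longrightarrow> u \<in> cball c R \<Longrightarrow> w u \<le> m - \<eta>" by auto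
  define \<epsilon> where "\<epsilon> = \<eta> / 2"
  have \<epsilon>: "\<epsilon> > 0" "\<epsilon> < \<eta>" using \<eta> by (auto simp: \<epsilon>_def)
  define W where "W u = w u + \<epsilon> * (h u - k)" for u
  have W_sphere: "W u < m" if "u \<in> sphere y s" for u
  proof (cases "u \<in> cball c R")
    case True
    have "k > 0" by (simp add: k_def)
    then have "h u - k < 1" using h_le[of u] by linarith
    then have "\<epsilon> * (h u - k) < \<epsilon> * 1" using \<epsilon> by (intro mult_strict_left_mono) auto
    then show ?thesis using \<eta>(2)[OF that True] \<epsilon> unfolding W_def by linarith
  next
    case False
    then have "h u < k" using h_out by (simp add: dist_commute)
    then have "\<epsilon> * (h u - k) < 0" using \<epsilon> by (simp add: mult_pos_neg)
    moreover have "w u \<le> m" using le that s by auto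
    ultimately show ?thesis by (simp add: W_def)
  qed
  have Wy: "W y = m" using hy y by (simp add: W_def)
  have "continuous_on ?K W"
    unfolding W_def h_def by (intro continuous_intros continuous_on_subset[OF contw s(3)])
  then obtain z where z: "z \<in> ?K" "\<And>u. u \<in> ?K \<Longrightarrow> W u \<le> W z"
    using continuous_attains_sup[of ?K W] Kne by auto
  have "W z \<ge> m" using z(2)[of y] Wy s by simp
  then have "z \<notin> sphere y s" using W_sphere[of z] by auto
  then have zb: "dist y z < s" using z by auto
  have zV: "z \<in> V" using z s by auto
  define r where "r = s - dist y z"
  have r: "r > 0" "ball z r \<subseteq> ?K" "ball z r \<subseteq> V"
  proof -
    show "r > 0" using zb by (simp add: r_def)
    show *: "ball z r \<subseteq> ?K"
    proof
      fix u assume "u \<in> ball z r"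
      then show "u \<in> ?K" using dist_triangle[of y u z] by (simp add: r_def)
    qed
    show "ball z r \<subseteq> V" using * s by auto
  qed
  have jetW: "has_jet2 V W (\<lambda>u. w\<^sub>1 u + \<epsilon> * (- 2 * \<alpha> * (u$1 - c$1) * h u))
    (\<lambda>u. w\<^sub>2 u + \<epsilon> * (- 2 * \<alpha> * (u$2 - c$2) * h u))
    (\<lambda>u. w\<^sub>1\<^sub>1 u + \<epsilon> * ((4 * \<alpha>\<^sup>2 * (u$1 - c$1)\<^sup>2 - 2 * \<alpha>) * h u))
    (\<lambda>u. w\<^sub>1\<^sub>2 u + \<epsilon> * (4 * \<alpha>\<^sup>2 * (u$1 - c$1) * (u$2 - c$2) * h u))
    (\<lambda>u. w\<^sub>2\<^sub>2 u + \<epsilon> * ((4 * \<alpha>\<^sup>2 * (u$2 - c$2)\<^sup>2 - 2 * \<alpha>) * h u))"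
    unfolding W_def h_def by (rule has_jet2_add_scaled[OF jet has_jet2_gaussian])
  have max: "W u \<le> W z" if "u \<in> ball z r" for u using z(2) r that by auto
  have pos: "0 < \<epsilon> * (h z * (4 * \<alpha>\<^sup>2 * Q z - 2 * \<alpha> * T z))"
    using \<alpha>Q[OF z(1)] \<epsilon> by (simp add: h_def)
  have "a\<^sub>1\<^sub>1 z * (w\<^sub>1\<^sub>1 z + \<epsilon> * ((4 * \<alpha>\<^sup>2 * (z$1 - c$1)\<^sup>2 - 2 * \<alpha>) * h z))
    + 2 * a\<^sub>1\<^sub>2 z * (w\<^sub>1\<^sub>2 z + \<epsilon> * (4 * \<alpha>\<^sup>2 * (z$1 - c$1) * (z$2 - c$2) * h z))
    + a\<^sub>2\<^sub>2 z * (w\<^sub>2\<^sub>2 z + \<epsilon> * ((4 * \<alpha>\<^sup>2 * (z$2 - c$2)\<^sup>2 - 2 * \<alpha>) * h z))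
    + b\<^sub>1 z * (w\<^sub>1 z + \<epsilon> * (- 2 * \<alpha> * (z$1 - c$1) * h z))
    + b\<^sub>2 z * (w\<^sub>2 z + \<epsilon> * (- 2 * \<alpha> * (z$2 - c$2) * h z)) \<le> 0"
    by (rule local_max_elliptic_le_0[OF jetW r(1,3) max ell(1)[OF zV] ell(2)[OF zV]])
  also have "a\<^sub>1\<^sub>1 z * (w\<^sub>1\<^sub>1 z + \<epsilon> * ((4 * \<alpha>\<^sup>2 * (z$1 - c$1)\<^sup>2 - 2 * \<alpha>) * h z))
    + 2 * a\<^sub>1\<^sub>2 z * (w\<^sub>1\<^sub>2 z + \<epsilon> * (4 * \<alpha>\<^sup>2 * (z$1 - c$1) * (z$2 - c$2) * h z))
    + a\<^sub>2\<^sub>2 z * (w\<^sub>2\<^sub>2 z + \<epsilon> * ((4 * \<alpha>\<^sup>2 * (z$2 - c$2)\<^sup>2 - 2 * \<alpha>) * h z))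
    + b\<^sub>1 z * (w\<^sub>1 z + \<epsilon> * (- 2 * \<alpha> * (z$1 - c$1) * h z))
    + b\<^sub>2 z * (w\<^sub>2 z + \<epsilon> * (- 2 * \<alpha> * (z$2 - c$2) * h z))
    = (a\<^sub>1\<^sub>1 z * w\<^sub>1\<^sub>1 z + 2 * a\<^sub>1\<^sub>2 z * w\<^sub>1\<^sub>2 z + a\<^sub>2\<^sub>2 z * w\<^sub>2\<^sub>2 z + b\<^sub>1 z * w\<^sub>1 z + b\<^sub>2 z * w\<^sub>2 z)
      + \<epsilon> * (h z * (4 * \<alpha>\<^sup>2 * Q z - 2 * \<alpha> * T z))"
    unfolding Q_def T_def by algebra
  finally show False using pos sub[OF zV] by linarith
qed

text \<open>Hopf's argument: if \<open>w\<close> were smaller than \<open>m\<close> at a point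
  \<open>y0\<close> near \<open>u\<^sub>0\<close>, a maximum point \<open>y\<close> closest to
  \<open>y0\<close> would be the only maximum point in some closed ball with \<open>y\<close> on its
  boundary.\<close>

lemma strong_maximum_principle_local:
  fixes w :: "real^2 \<Rightarrow> real"
  assumes V: "open V" and jet: "has_jet2 V w w\<^sub>1 w\<^sub>2 w\<^sub>1\<^sub>1 w\<^sub>1\<^sub>2 w\<^sub>2\<^sub>2"
    and cont: "continuous_on V a\<^sub>1\<^sub>1" "continuous_on V a\<^sub>1\<^sub>2" "continuous_on V a\<^sub>2\<^sub>2"
      "continuous_on V b\<^sub>1" "continuous_on V b\<^sub>2"
    and ell: "\<And>u. u \<in> V \<Longrightarrow> a\<^sub>1\<^sub>1 u > 0" "\<And>u. u \<in> V \<Longrightarrow> a\<^sub>1\<^sub>1 u * a\<^sub>2\<^sub>2 u - (a\<^sub>1\<^sub>2 u)\<^sup>2 > 0"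
    and sub: "\<And>u. u \<in> V \<Longrightarrow>
      0 \<le> a\<^sub>1\<^sub>1 u * w\<^sub>1\<^sub>1 u + 2 * a\<^sub>1\<^sub>2 u * w\<^sub>1\<^sub>2 u + a\<^sub>2\<^sub>2 u * w\<^sub>2\<^sub>2 u + b\<^sub>1 u * w\<^sub>1 u + b\<^sub>2 u * w\<^sub>2 u"
    and le: "\<And>u. u \<in> V \<Longrightarrow> w u \<le> m"
    and u0: "u\<^sub>0 \<in> V" "w u\<^sub>0 = m"
  shows "\<exists>\<delta>>0. ball u\<^sub>0 \<delta> \<subseteq> V \<and> (\<forall>u\<in>ball u\<^sub>0 \<delta>. w u = m)"
proof -
  obtain d where d: "d > 0" "cball u\<^sub>0 d \<subseteq> V"
    using V u0 open_contains_cball by blast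
  have contw: "continuous_on V w"
    using has_jet2D(1)[OF jet] by (meson continuous_at_imp_continuous_on has_derivative_continuous)
  define F where "F = {u \<in> cball u\<^sub>0 d. w u = m}"
  have "closed F"
    unfolding F_def by (rule continuous_closed_preimage_constant)
      (use continuous_on_subset[OF contw d(2)] in auto)
  have F0: "u\<^sub>0 \<in> F" using u0 d by (simp add: F_def)
  \<comment> \<open>With \<open>y0\<close> within \<open>d/2\<close> of \<open>u\<^sub>0\<close>,
    every maximum point no farther from \<open>y0\<close> than \<open>y\<close> lies in
    \<open>cball u\<^sub>0 d\<close>, hence in \<open>F\<close>.\<close>
  have "w y0 = m" if y0: "y0 \<in> ball u\<^sub>0 (d/2)" for y0
  proof (rule ccontr)
    assume neq: "w y0 \<noteq> m"
    obtain y where y: "y \<in> F" "\<And>u. u \<in> F \<Longrightarrow> dist y0 y \<le> dist y0 u"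
      using distance_attains_inf[OF \<open>closed F\<close>, where a = y0] F0 by blast
    have yV: "y \<in> V" "w y = m" using y d by (auto simp: F_def)
    define R where "R = dist y0 y / 2"
    have R: "R > 0" using yV neq by (auto simp: R_def)
    \<comment> \<open>The ball about \<open>y0\<close> through \<open>y\<close> may meet
      \<open>F\<close> at other boundary points. The ball of half that radius, internally tangent at
      \<open>y\<close>, does not.\<close>
    define c where "c = (1/2) *\<^sub>R (y0 + y)"
    have "y - c = (1/2) *\<^sub>R (y - y0)" unfolding c_def by (simp add: vec_eq_iff field_simps)
    then have yc: "dist y c = R"
      by (simp add: R_def dist_norm norm_minus_commute)
    have Rd: "dist y0 y < d/2" using y(2)[OF F0] y0 by (simp add: dist_commute)
    have "w u < m" if u: "u \<in> V" "u \<in> cball c R" "u \<noteq> y" for u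
    proof (rule ccontr)
      assume "\<not> w u < m"
      then have "w u = m" using le[OF u(1)] by simp
      have "dist y0 u \<le> dist y0 c + dist c u" by (rule dist_triangle)
      moreover have "dist y0 c = R"
      proof -
        have "y0 - c = (1/2) *\<^sub>R (y0 - y)" unfolding c_def by (simp add: vec_eq_iff field_simps)
        then show ?thesis by (simp add: R_def dist_norm)
      qed
      ultimately have le2: "dist y0 u \<le> dist y0 y" using u(2) by (simp add: R_def)
      then have "dist u\<^sub>0 u \<le> d"
        using dist_triangle[of u\<^sub>0 u y0] y0 Rd by simp
      then have "u \<in> F" using \<open>w u = m\<close> by (simp add: F_def)
      then have eq: "dist y0 u = dist y0 y" using y(2) le2 by force
      have "norm (u - y0) = 2 * R" using eq by (simp add: R_def dist_norm norm_minus_commute)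
      moreover have "norm (u - c) \<le> R" using u(2) by (simp add: dist_norm norm_minus_commute)
      moreover have "norm (y - y0) = 2 * R" by (simp add: R_def dist_norm norm_minus_commute)
      \<comment> \<open>The median formula in the triangle \<open>y0\<close>, \<open>y\<close>,
        \<open>u\<close>. With both sides at \<open>y0\<close> of length 2R it gives R^2 + |u - y|^2
        / 2, so a point \<open>u\<close> of the smaller ball must be \<open>y\<close>.\<close>
      moreover have "(norm (u - c))\<^sup>2 = (norm (u - y0))\<^sup>2 / 2 + (norm (u - y))\<^sup>2 / 2 - (norm (y - y0))\<^sup>2 / 4"
        unfolding c_def power2_norm_eq_inner inner_vec_def sum_2 by (simp add: field_simps)
      moreover have "(norm (u - c))\<^sup>2 \<le> R\<^sup>2"
        using u(2) by (intro power_mono) (auto simp: dist_norm norm_minus_commute)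
      ultimately have "R\<^sup>2 + (norm (u - y))\<^sup>2 / 2 \<le> R\<^sup>2"
        by (simp add: power2_eq_square)
      then show False using u(3) by simp
    qed
    then show False
      using no_touching_ball[OF V jet cont ell sub le yV R yc] by blast
  qed
  then show ?thesis using d by (intro exI[of _ "d/2"]) (auto simp: subset_iff)
qed

section \<open>Charts of self-shrinkers\<close>

definition hprod :: "complex^2 \<Rightarrow> complex^2 \<Rightarrow> complex" where
  "hprod a b = cnj (a$1) * b$1 + cnj (a$2) * b$2"

definition cdet :: "complex^2 \<Rightarrow> complex^2 \<Rightarrow> complex" where
  "cdet a b = a$1 * b$2 - a$2 * b$1"

lemma inner_eq_Re_hprod: "a \<bullet> b = Re (hprod a b)"
  by (simp add: hprod_def inner_vec_def sum_2 inner_complex_def)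

lemma kaehler_eq_Im_hprod: "kaehler a b = Im (hprod a b)"
  by (simp add: kaehler_def Jc_def hprod_def inner_vec_def sum_2 inner_complex_def)

lemma Re_hprod_commute: "Re (hprod a b) = Re (hprod b a)"
  by (simp add: hprod_def)

lemma Im_hprod_commute: "Im (hprod a b) = - Im (hprod b a)"
  by (simp add: hprod_def)

text \<open>Cauchy-Binet in dimension two. It turns statements about the phase of a determinant into
  statements about hermitian products, which are real on a Lagrangian frame.\<close>

lemma cnj_cdet_mult_cdet: "cnj (cdet a b) * cdet c d = hprod a c * hprod b d - hprod a d * hprod b c"
  by (simp add: cdet_def hprod_def algebra_simps)

lemma real2_decompose: "h = (h$1) *\<^sub>R e1 + (h$2) *\<^sub>R e2"
  by (simp add: vec_eq_iff forall_2 e1_def e2_def axis_def)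

lemma partials_eq_dirD: "fu f = dirD f e1" "fv f = dirD f e2" "fuu f = dirD (dirD f e1) e1"
  "fuv f = dirD (dirD f e1) e2" "fvv f = dirD (dirD f e2) e2"
  by (simp_all add: fun_eq_iff fu_def fv_def fuu_def fuv_def fvv_def)

lemma has_derivative_partials:
  fixes f :: "real^2 \<Rightarrow> 'b::real_normed_vector"
  assumes "f differentiable (at u)"
  shows "(f has_derivative (\<lambda>h. (h$1) *\<^sub>R dirD f e1 u + (h$2) *\<^sub>R dirD f e2 u)) (at u)"
proof -
  note d = has_derivative_dirD[OF assms]
  have "dirD f h u = (h$1) *\<^sub>R dirD f e1 u + (h$2) *\<^sub>R dirD f e2 u" for h
    using linear_add[OF has_derivative_linear[OF d]] linear_cmul[OF has_derivative_linear[OF d]]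
      real2_decompose[of h] by metis
  then show ?thesis by (intro has_derivative_eq_rhs[OF d] ext)
qed

section \<open>Metric, projections and Laplacian in a chart\<close>

locale immersion_chart =
  fixes V :: "(real^2) set" and f :: "real^2 \<Rightarrow> complex^2"
  assumes open_V: "open V" and smooth: "smooth_on f V"
    and imm: "\<And>u. u \<in> V \<Longrightarrow> inj (frechet_derivative f (at u))"
begin

lemmas C2 = Ck_on_2_D[OF open_V smooth[unfolded smooth_on_def, THEN spec[where x = 2]]]

lemma jet: "has_jet2 V f (fu f) (fv f) (fuu f) (fuv f) (fvv f)"
  unfolding has_jet2_def
proof (intro ballI conjI)
  fix u assume u: "u \<in> V"
  show "(f has_derivative (\<lambda>h. (h$1) *\<^sub>R fu f u + (h$2) *\<^sub>R fv f u)) (at u)"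
    unfolding partials_eq_dirD by (rule has_derivative_partials[OF C2(1)[OF u]])
  show "(fu f has_derivative (\<lambda>h. (h$1) *\<^sub>R fuu f u + (h$2) *\<^sub>R fuv f u)) (at u)"
    unfolding partials_eq_dirD by (rule has_derivative_partials[OF C2(2)[OF u]])
  have "dirD (dirD f e1) e2 u = dirD (dirD f e2) e1 u"
    by (rule dirD_commute[OF open_V u]) (use smooth in \<open>simp add: smooth_on_def\<close>)
  then show "(fv f has_derivative (\<lambda>h. (h$1) *\<^sub>R fuv f u + (h$2) *\<^sub>R fvv f u)) (at u)"
    unfolding partials_eq_dirD using has_derivative_partials[OF C2(2)[OF u], of e2] by simp
qed

lemma cont: "continuous_on V f" "continuous_on V (fu f)" "continuous_on V (fv f)"
  "continuous_on V (fuu f)" "continuous_on V (fuv f)" "continuous_on V (fvv f)"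
proof -
  show "continuous_on V f" "continuous_on V (fu f)" "continuous_on V (fv f)"
    using has_jet2D[OF jet] by (meson continuous_at_imp_continuous_on has_derivative_continuous)+
  show "continuous_on V (fuu f)" "continuous_on V (fuv f)" "continuous_on V (fvv f)"
    unfolding partials_eq_dirD by (rule C2(3))+
qed

lemma partials_independent:
  assumes "u \<in> V" "a *\<^sub>R fu f u + b *\<^sub>R fv f u = 0"
  shows "a = 0" "b = 0"
proof -
  let ?h = "a *\<^sub>R e1 + b *\<^sub>R e2"
  have comp: "?h $ 1 = a" "?h $ 2 = b"
    by (simp_all add: e1_def e2_def axis_def)
  have "frechet_derivative f (at u) = (\<lambda>h. (h$1) *\<^sub>R fu f u + (h$2) *\<^sub>R fv f u)"
    using frechet_derivative_at[OF has_jet2D(1)[OF jet assms(1)]] by simp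
  then have "frechet_derivative f (at u) ?h = frechet_derivative f (at u) 0"
    using assms(2) by (simp only: comp) simp
  then have "?h = 0" using imm[OF assms(1)] by (simp add: inj_eq)
  then show "a = 0" "b = 0" using comp by auto
qed

lemma gdet_pos:
  assumes u: "u \<in> V"
  shows "g11 f u > 0" "g22 f u > 0" "gdet f u > 0"
proof -
  have "fu f u \<noteq> 0" "fv f u \<noteq> 0"
    using partials_independent[OF u, of 1 0] partials_independent[OF u, of 0 1] by auto
  then show 1: "g11 f u > 0" and 2: "g22 f u > 0"
    by (simp_all add: g11_def g22_def)
  \<comment> \<open>This is \<open>g22 f u\<close> times the component of \<open>fu f u\<close>
    orthogonal to \<open>fv f u\<close>.\<close>
  let ?x = "g22 f u *\<^sub>R fu f u + (- g12 f u) *\<^sub>R fv f u"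
  have "?x \<noteq> 0" using partials_independent[OF u, of "g22 f u" "- g12 f u"] 2 by auto
  then have "0 < ?x \<bullet> ?x" by simp
  also have "?x \<bullet> ?x = g22 f u * gdet f u"
    by (simp add: gdet_def g11_def g22_def g12_def inner_add_left inner_add_right inner_diff_left inner_diff_right
        inner_commute[of "fv f u" "fu f u"] power2_eq_square algebra_simps)
  finally show "gdet f u > 0" using 2 by (simp add: zero_less_mult_iff)
qed

text \<open>Coordinates of the tangential part in the coordinate frame. At \<open>trace_hess\<close>
  they are the contracted Christoffel symbols g^ij Gamma^k_ij, so with a minus sign they are the
  first-order coefficients of the Laplacian.\<close>

definition tan_coeff1 where "tan_coeff1 u w = gi11 f u * (w \<bullet> fu f u) + gi12 f u * (w \<bullet> fv f u)"
definition tan_coeff2 where "tan_coeff2 u w = gi12 f u * (w \<bullet> fu f u) + gi22 f u * (w \<bullet> fv f u)"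

lemma tan_proj_eq: "tan_proj f u w = tan_coeff1 u w *\<^sub>R fu f u + tan_coeff2 u w *\<^sub>R fv f u"
  by (simp add: tan_proj_def tan_coeff1_def tan_coeff2_def)

lemma gi_identities:
  assumes "u \<in> V"
  shows "gi11 f u * g11 f u + gi12 f u * g12 f u = 1" "gi12 f u * g11 f u + gi22 f u * g12 f u = 0"
    "gi11 f u * g12 f u + gi12 f u * g22 f u = 0" "gi12 f u * g12 f u + gi22 f u * g22 f u = 1"
proof -
  have "gdet f u \<noteq> 0" using gdet_pos[OF assms] by simp
  then show "gi11 f u * g11 f u + gi12 f u * g12 f u = 1" "gi12 f u * g11 f u + gi22 f u * g12 f u = 0"
    "gi11 f u * g12 f u + gi12 f u * g22 f u = 0" "gi12 f u * g12 f u + gi22 f u * g22 f u = 1"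
    unfolding gi11_def gi12_def gi22_def
    by (simp_all add: divide_simps) (simp_all add: gdet_def power2_eq_square algebra_simps)
qed

lemma nor_proj_orthogonal:
  assumes "u \<in> V"
  shows "nor_proj f u w \<bullet> fu f u = 0" "nor_proj f u w \<bullet> fv f u = 0"
proof -
  have "nor_proj f u w \<bullet> fu f u = (w \<bullet> fu f u) * (1 - (gi11 f u * g11 f u + gi12 f u * g12 f u))
      - (w \<bullet> fv f u) * (gi12 f u * g11 f u + gi22 f u * g12 f u)"
    by (simp add: nor_proj_def tan_proj_def g11_def g12_def inner_diff_left inner_add_left
        inner_commute[of "fv f u" "fu f u"] algebra_simps)
  then show "nor_proj f u w \<bullet> fu f u = 0" using gi_identities[OF assms] by simp
  have "nor_proj f u w \<bullet> fv f u = (w \<bullet> fv f u) * (1 - (gi12 f u * g12 f u + gi22 f u * g22 f u))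
      - (w \<bullet> fu f u) * (gi11 f u * g12 f u + gi12 f u * g22 f u)"
    by (simp add: nor_proj_def tan_proj_def g22_def g12_def inner_diff_left inner_add_left algebra_simps)
  then show "nor_proj f u w \<bullet> fv f u = 0" using gi_identities[OF assms] by simp
qed

definition trace_hess where
  "trace_hess u = gi11 f u *\<^sub>R fuu f u + (2 * gi12 f u) *\<^sub>R fuv f u + gi22 f u *\<^sub>R fvv f u"

lemma mean_curv_eq: "mean_curv f u = nor_proj f u (trace_hess u)"
  by (simp add: mean_curv_def nor_proj_def tan_proj_def trace_hess_def inner_add_left algebra_simps)

lemma gi_continuous: "continuous_on V (gi11 f)" "continuous_on V (gi12 f)" "continuous_on V (gi22 f)"
  "continuous_on V (\<lambda>u. tan_coeff1 u (trace_hess u))" "continuous_on V (\<lambda>u. tan_coeff2 u (trace_hess u))"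
proof -
  have g: "continuous_on V (g11 f)" "continuous_on V (g12 f)" "continuous_on V (g22 f)"
    unfolding g11_def g12_def g22_def by (intro continuous_on_inner cont)+
  then have d: "continuous_on V (gdet f)"
    unfolding gdet_def by (intro continuous_intros)
  have ne: "\<forall>u\<in>V. gdet f u \<noteq> 0" using gdet_pos by force
  show gi: "continuous_on V (gi11 f)" "continuous_on V (gi12 f)" "continuous_on V (gi22 f)"
    unfolding gi11_def gi12_def gi22_def
    by (intro continuous_on_divide continuous_on_minus g d ne)+
  have t: "continuous_on V trace_hess"
    unfolding trace_hess_def by (intro continuous_intros gi cont)
  show "continuous_on V (\<lambda>u. tan_coeff1 u (trace_hess u))" "continuous_on V (\<lambda>u. tan_coeff2 u (trace_hess u))"
    unfolding tan_coeff1_def tan_coeff2_def by (intro continuous_intros gi cont t)+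
qed

lemma gi_pos:
  assumes "u \<in> V"
  shows "gi11 f u > 0" "gi11 f u * gi22 f u - (gi12 f u)\<^sup>2 > 0"
proof -
  note p = gdet_pos[OF assms]
  show "gi11 f u > 0" using p by (simp add: gi11_def)
  have "gi11 f u * gi22 f u - (gi12 f u)\<^sup>2 = (g11 f u * g22 f u - (g12 f u)\<^sup>2) / (gdet f u)\<^sup>2"
    by (simp add: gi11_def gi12_def gi22_def power2_eq_square diff_divide_distrib mult.commute)
  then show "gi11 f u * gi22 f u - (gi12 f u)\<^sup>2 > 0"
    using p by (simp add: gdet_def[symmetric])
qed

text \<open>The factor \<open>c\<close> will be 1 or -1, so that maxima and minima of the squared
  norm are treated at once.\<close>

lemma jet_norm_squared:
  "has_jet2 V (\<lambda>u. c * (f u \<bullet> f u)) (\<lambda>u. 2 * c * (f u \<bullet> fu f u)) (\<lambda>u. 2 * c * (f u \<bullet> fv f u))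
    (\<lambda>u. 2 * c * (fu f u \<bullet> fu f u + f u \<bullet> fuu f u)) (\<lambda>u. 2 * c * (fu f u \<bullet> fv f u + f u \<bullet> fuv f u))
    (\<lambda>u. 2 * c * (fv f u \<bullet> fv f u + f u \<bullet> fvv f u))"
  unfolding has_jet2_def
proof (intro ballI conjI)
  fix u assume u: "u \<in> V"
  note d = has_jet2D[OF jet u]
  show "((\<lambda>u. c * (f u \<bullet> f u)) has_derivative
      (\<lambda>h. h $ 1 *\<^sub>R (2 * c * (f u \<bullet> fu f u)) + h $ 2 *\<^sub>R (2 * c * (f u \<bullet> fv f u)))) (at u)"
    by (rule has_derivative_eq_rhs, rule has_derivative_mult_right, rule has_derivative_inner[OF d(1) d(1)])
      (auto simp: fun_eq_iff inner_add_left inner_add_right inner_commute algebra_simps)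
  show "((\<lambda>u. 2 * c * (f u \<bullet> fu f u)) has_derivative
      (\<lambda>h. h $ 1 *\<^sub>R (2 * c * (fu f u \<bullet> fu f u + f u \<bullet> fuu f u)) + h $ 2 *\<^sub>R (2 * c * (fu f u \<bullet> fv f u + f u \<bullet> fuv f u)))) (at u)"
    by (rule has_derivative_eq_rhs, rule has_derivative_mult_right, rule has_derivative_inner[OF d(1) d(2)])
      (auto simp: fun_eq_iff inner_add_left inner_add_right inner_commute algebra_simps)
  show "((\<lambda>u. 2 * c * (f u \<bullet> fv f u)) has_derivative
      (\<lambda>h. h $ 1 *\<^sub>R (2 * c * (fu f u \<bullet> fv f u + f u \<bullet> fuv f u)) + h $ 2 *\<^sub>R (2 * c * (fv f u \<bullet> fv f u + f u \<bullet> fvv f u)))) (at u)"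
    by (rule has_derivative_eq_rhs, rule has_derivative_mult_right, rule has_derivative_inner[OF d(1) d(3)])
      (auto simp: fun_eq_iff inner_add_left inner_add_right inner_commute algebra_simps)
qed

end

section \<open>The squared distance to the origin on a self-shrinker\<close>

locale shrinker_chart = immersion_chart +
  assumes shr: "\<And>u. u \<in> V \<Longrightarrow> mean_curv f u = - nor_proj f u (f u)"
begin

text \<open>H is normal, so it sees only the normal part of the position vector, which is
  -H.\<close>

lemma mean_curv_inner:
  assumes "u \<in> V"
  shows "mean_curv f u \<bullet> f u = - (norm (mean_curv f u))\<^sup>2"
proof -
  have "mean_curv f u \<bullet> tan_proj f u (f u) = 0"
    unfolding mean_curv_eq tan_proj_eq using nor_proj_orthogonal[OF assms] by (simp add: inner_add_right)
  then have "mean_curv f u \<bullet> f u = mean_curv f u \<bullet> nor_proj f u (f u)"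
    by (simp add: nor_proj_def inner_diff_right)
  also have "\<dots> = - (mean_curv f u \<bullet> mean_curv f u)"
    using shr[OF assms] by simp
  finally show ?thesis by (simp add: power2_norm_eq_inner)
qed

text \<open>The first derivatives contribute the trace of the metric, which is 2. The rest is the
  product of \<open>f\<close> with its Laplacian, which is the mean curvature vector.\<close>

lemma laplacian_norm_squared:
  assumes u: "u \<in> V"
  shows "gi11 f u * (2 * c * (fu f u \<bullet> fu f u + f u \<bullet> fuu f u))
    + 2 * gi12 f u * (2 * c * (fu f u \<bullet> fv f u + f u \<bullet> fuv f u))
    + gi22 f u * (2 * c * (fv f u \<bullet> fv f u + f u \<bullet> fvv f u))
    + (- tan_coeff1 u (trace_hess u)) * (2 * c * (f u \<bullet> fu f u)) + (- tan_coeff2 u (trace_hess u)) * (2 * c * (f u \<bullet> fv f u))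
    = 2 * c * (2 - (norm (mean_curv f u))\<^sup>2)" (is "?L = _")
proof -
  have tr: "gi11 f u * g11 f u + 2 * gi12 f u * g12 f u + gi22 f u * g22 f u = 2"
    using gi_identities[OF u] by linarith
  have "mean_curv f u \<bullet> f u = gi11 f u * (f u \<bullet> fuu f u) + 2 * gi12 f u * (f u \<bullet> fuv f u) + gi22 f u * (f u \<bullet> fvv f u)
    - tan_coeff1 u (trace_hess u) * (f u \<bullet> fu f u) - tan_coeff2 u (trace_hess u) * (f u \<bullet> fv f u)"
    unfolding mean_curv_eq nor_proj_def tan_proj_eq
    by (subst inner_commute) (simp add: inner_diff_right inner_add_right, simp add: trace_hess_def inner_add_right)
  with mean_curv_inner[OF u] have H: "gi11 f u * (f u \<bullet> fuu f u) + 2 * gi12 f u * (f u \<bullet> fuv f u) + gi22 f u * (f u \<bullet> fvv f u)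
    - tan_coeff1 u (trace_hess u) * (f u \<bullet> fu f u) - tan_coeff2 u (trace_hess u) * (f u \<bullet> fv f u) = - (norm (mean_curv f u))\<^sup>2"
    by simp
  have "?L = 2 * c * ((gi11 f u * g11 f u + 2 * gi12 f u * g12 f u + gi22 f u * g22 f u)
    + (gi11 f u * (f u \<bullet> fuu f u) + 2 * gi12 f u * (f u \<bullet> fuv f u) + gi22 f u * (f u \<bullet> fvv f u)
    - tan_coeff1 u (trace_hess u) * (f u \<bullet> fu f u) - tan_coeff2 u (trace_hess u) * (f u \<bullet> fv f u)))"
    unfolding g11_def g12_def g22_def by (simp add: algebra_simps)
  then show ?thesis
    unfolding tr H by simp
qed

lemma norm_squared_locally_constant:
  assumes c: "\<And>u. u \<in> V \<Longrightarrow> 0 \<le> c * (2 - (norm (mean_curv f u))\<^sup>2)"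
    and le: "\<And>u. u \<in> V \<Longrightarrow> c * (f u \<bullet> f u) \<le> m"
    and u0: "u\<^sub>0 \<in> V" "c * (f u\<^sub>0 \<bullet> f u\<^sub>0) = m"
  shows "\<exists>\<delta>>0. ball u\<^sub>0 \<delta> \<subseteq> V \<and> (\<forall>u\<in>ball u\<^sub>0 \<delta>. c * (f u \<bullet> f u) = m)"
proof (rule strong_maximum_principle_local[OF open_V jet_norm_squared gi_continuous(1-3)
      gi_continuous(4,5)[THEN continuous_on_minus] gi_pos])
  fix u assume u: "u \<in> V"
  show "0 \<le> gi11 f u * (2 * c * (fu f u \<bullet> fu f u + f u \<bullet> fuu f u))
    + 2 * gi12 f u * (2 * c * (fu f u \<bullet> fv f u + f u \<bullet> fuv f u))
    + gi22 f u * (2 * c * (fv f u \<bullet> fv f u + f u \<bullet> fvv f u))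
    + (- tan_coeff1 u (trace_hess u)) * (2 * c * (f u \<bullet> fu f u)) + (- tan_coeff2 u (trace_hess u)) * (2 * c * (f u \<bullet> fv f u))"
    unfolding laplacian_norm_squared[OF u] using c[OF u] by simp
qed (use le u0 in auto)

text \<open>The value \<open>m\<close> is not prescribed. Differentiating once makes
  \<open>f\<close> normal, hence H = -f by the shrinker equation; differentiating twice makes the
  Laplacian of |f|^2 vanish, hence |H|^2 = 2. Together they fix the radius.\<close>

lemma spherical_chart:
  assumes const: "\<And>u. u \<in> V \<Longrightarrow> f u \<bullet> f u = m" and u: "u \<in> V"
  shows "f u \<bullet> fu f u = 0" "f u \<bullet> fv f u = 0" "f u \<bullet> f u = 2" "mean_curv f u = - f u"
proof -
  have zero: "((\<lambda>u. 1 * (f u \<bullet> f u)) has_derivative (\<lambda>h. 0)) (at u)" if "u \<in> V" for u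
    by (rule has_derivative_transform_within_open[of "\<lambda>u. m", OF has_derivative_const open_V that])
      (use const in auto)
  have fi: "f u \<bullet> fu f u = 0 \<and> f u \<bullet> fv f u = 0" if "u \<in> V" for u
  proof -
    have eq: "(\<lambda>h::real^2. h $ 1 *\<^sub>R (2 * 1 * (f u \<bullet> fu f u)) + h $ 2 *\<^sub>R (2 * 1 * (f u \<bullet> fv f u))) = (\<lambda>h. 0)"
      by (rule has_derivative_unique[OF has_jet2D(1)[OF jet_norm_squared that] zero[OF that]])
    show ?thesis
      using fun_cong[OF eq, of e1] fun_cong[OF eq, of e2] by (simp add: e1_def e2_def axis_def)
  qed
  show fi1: "f u \<bullet> fu f u = 0" and fi2: "f u \<bullet> fv f u = 0" using fi[OF u] by auto
  have zero1: "((\<lambda>u. 2 * 1 * (f u \<bullet> fu f u)) has_derivative (\<lambda>h. 0)) (at u)"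
    by (rule has_derivative_transform_within_open[of "\<lambda>u. 0", OF has_derivative_const open_V u])
      (use fi in auto)
  have zero2: "((\<lambda>u. 2 * 1 * (f u \<bullet> fv f u)) has_derivative (\<lambda>h. 0)) (at u)"
    by (rule has_derivative_transform_within_open[of "\<lambda>u. 0", OF has_derivative_const open_V u])
      (use fi in auto)
  have eq1: "(\<lambda>h::real^2. h $ 1 *\<^sub>R (2 * 1 * (fu f u \<bullet> fu f u + f u \<bullet> fuu f u)) + h $ 2 *\<^sub>R (2 * 1 * (fu f u \<bullet> fv f u + f u \<bullet> fuv f u))) = (\<lambda>h. 0)"
    by (rule has_derivative_unique[OF has_jet2D(2)[OF jet_norm_squared u] zero1])
  have eq2: "(\<lambda>h::real^2. h $ 1 *\<^sub>R (2 * 1 * (fu f u \<bullet> fv f u + f u \<bullet> fuv f u)) + h $ 2 *\<^sub>R (2 * 1 * (fv f u \<bullet> fv f u + f u \<bullet> fvv f u))) = (\<lambda>h. 0)"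
    by (rule has_derivative_unique[OF has_jet2D(3)[OF jet_norm_squared u] zero2])
  have z: "fu f u \<bullet> fu f u + f u \<bullet> fuu f u = 0" "fu f u \<bullet> fv f u + f u \<bullet> fuv f u = 0" "fv f u \<bullet> fv f u + f u \<bullet> fvv f u = 0"
    using fun_cong[OF eq1, of e1] fun_cong[OF eq1, of e2] fun_cong[OF eq2, of e2]
    by (simp_all add: e1_def e2_def axis_def)
  have H2: "(norm (mean_curv f u))\<^sup>2 = 2"
    using laplacian_norm_squared[OF u, of 1] unfolding z fi1 fi2 by simp
  have "tan_proj f u (f u) = 0" by (simp add: tan_proj_def fi1 fi2)
  then show H: "mean_curv f u = - f u" using shr[OF u] by (simp add: nor_proj_def)
  show "f u \<bullet> f u = 2" using H2 unfolding H power2_norm_eq_inner by simp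
qed

end

section \<open>Lagrangian charts in the sphere\<close>

lemma bounded_linear_Jc: "bounded_linear Jc"
proof (rule linear_conv_bounded_linear[THEN iffD1], rule linearI)
  show "Jc (a + b) = Jc a + Jc b" for a b
    by (simp add: Jc_def vec_eq_iff algebra_simps)
  show "Jc (c *\<^sub>R b) = c *\<^sub>R Jc b" for c b
    by (simp add: Jc_def vec_eq_iff)
qed

lemma kaehler_add_scaled:
  "kaehler a (x *\<^sub>R b + y *\<^sub>R c) = x * kaehler a b + y * kaehler a c"
  "kaehler (x *\<^sub>R b + y *\<^sub>R c) a = x * kaehler b a + y * kaehler c a"
  by (simp_all add: kaehler_eq_Im_hprod hprod_def algebra_simps)

lemma kaehler_self: "kaehler a a = 0"
  by (simp add: kaehler_eq_Im_hprod hprod_def)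

lemma kaehler_commute: "kaehler a b = - kaehler b a"
  by (simp add: kaehler_eq_Im_hprod hprod_def)

text \<open>Only the imaginary part of D'/D turns the phase; the real part changes the modulus and
  cancels in the quotient. Working with the phase itself avoids choosing a branch of the
  argument.\<close>

lemma has_derivative_phase:
  fixes D :: "'a::real_normed_vector \<Rightarrow> complex"
  assumes D: "(D has_derivative D') (at u)" and nz: "D u \<noteq> 0"
    and th: "\<And>h. Im (cnj (D u) * D' h) = \<theta> h * (cmod (D u))\<^sup>2"
  shows "((\<lambda>u. D u / of_real (cmod (D u))) has_derivative
    (\<lambda>h. \<i> * of_real (\<theta> h) * (D u / of_real (cmod (D u))))) (at u)"
proof -
  let ?n = "cmod (D u)"
  have n: "?n \<noteq> 0" using nz by simp
  have dn: "((\<lambda>u. cmod (D u)) has_derivative (\<lambda>h. sgn (D u) \<bullet> D' h)) (at u)"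
    using has_derivative_compose[OF D has_derivative_norm[OF nz]] by (simp add: inner_commute)
  have *: "((\<lambda>u. D u / of_real (cmod (D u))) has_derivative
     (\<lambda>h. (D' h * of_real ?n - D u * of_real (sgn (D u) \<bullet> D' h)) / (of_real ?n * of_real ?n))) (at u)"
    by (rule has_derivative_divide'[OF D has_derivative_of_real[OF dn]]) (use n in simp)
  have "(D' h * of_real ?n - D u * of_real (sgn (D u) \<bullet> D' h)) / (of_real ?n * of_real ?n)
      = \<i> * of_real (\<theta> h) * (D u / of_real ?n)" for h
  proof -
    define A where "A = cnj (D u) * D' h"
    have nn: "complex_of_real ?n * of_real ?n = D u * cnj (D u)"
      by (metis complex_norm_square power2_eq_square of_real_mult)
    have sg: "sgn (D u) \<bullet> D' h = Re A / ?n"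
      by (simp add: A_def sgn_div_norm inner_complex_def divide_inverse algebra_simps)
    have "A = of_real (Re A) + \<i> * of_real (\<theta> h) * (D u * cnj (D u))"
      using th[of h] by (subst nn[symmetric]) (simp add: complex_eq_iff A_def[symmetric] power2_eq_square)
    then have "D u * (cnj (D u) * D' h) = D u * (of_real (Re A) + \<i> * of_real (\<theta> h) * (D u * cnj (D u)))"
      by (simp add: A_def)
    then have "D' h * (of_real ?n * of_real ?n) = D u * of_real (Re A) + \<i> * of_real (\<theta> h) * D u * (of_real ?n * of_real ?n)"
      unfolding nn by (simp add: algebra_simps)
    then show ?thesis
      unfolding sg using n by (simp add: divide_simps) (simp add: algebra_simps)
  qed
  then show ?thesis by (intro has_derivative_eq_rhs[OF *] ext)
qed

text \<open>
  For \<open>|p|\<^sup>2 + 4 r\<^sup>2 = 4\<close> this says that the Hopf projection of \<open>v\<close> lies on the great circle with pole \<open>(p, r)\<close>,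
  so \<open>(p, r)\<close> and \<open>(-p, -r)\<close> describe the same torus.
\<close>

definition torus_rel :: "complex \<Rightarrow> real \<Rightarrow> complex^2 \<Rightarrow> bool" where
  "torus_rel p r v \<longleftrightarrow> r * ((cmod (v$2))\<^sup>2 - (cmod (v$1))\<^sup>2) + Re (p * cnj (v$1) * v$2) = 0"

lemma torus_rel_uminus: "torus_rel (- p) (- r) v \<longleftrightarrow> torus_rel p r v"
  unfolding torus_rel_def by (auto simp: algebra_simps)

text \<open>Doubling the real part gives a polynomial in the coordinates and their conjugates, a
  form in which identities can be checked by plain ring algebra.\<close>

lemma torus_rel_complex:
  "torus_rel p r v \<longleftrightarrow> 2 * of_real r * (v$2 * cnj (v$2) - v$1 * cnj (v$1)) + (p * cnj (v$1) * v$2 + cnj p * v$1 * cnj (v$2)) = 0"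
    (is "_ \<longleftrightarrow> ?C = 0")
proof -
  have "p * cnj (v$1) * v$2 + cnj p * v$1 * cnj (v$2) = of_real (2 * Re (p * cnj (v$1) * v$2))"
    using complex_add_cnj[of "p * cnj (v$1) * v$2"] by simp
  then have "?C = of_real (2 * (r * ((cmod (v$2))\<^sup>2 - (cmod (v$1))\<^sup>2) + Re (p * cnj (v$1) * v$2)))"
    by (simp add: complex_norm_square[symmetric])
  then have "?C = 0 \<longleftrightarrow> 2 * (r * ((cmod (v$2))\<^sup>2 - (cmod (v$1))\<^sup>2) + Re (p * cnj (v$1) * v$2)) = 0"
    by (simp only: of_real_eq_0_iff)
  moreover have "2 * x = 0 \<longleftrightarrow> x = 0" for x :: real by simp
  ultimately show ?thesis by (simp only: torus_rel_def)
qed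

text \<open>The great circles through the Hopf image of \<open>v\<close>, with a chosen pole, form a
  circle, and \<open>\<mu>\<close> is the coordinate on it. For a surface point the phase
  \<open>cnj E\<close> gives the pole belonging to the tangent plane.\<close>

lemma torus_rel_phase:
  assumes t: "torus_rel p r v" and n: "v$1 * cnj (v$1) + v$2 * cnj (v$2) = 2"
    and pr: "p * cnj p + 4 * (of_real r)\<^sup>2 = 4"
  obtains \<mu> where "\<mu> * cnj \<mu> = 1" "p = \<mu> * (v$1)\<^sup>2 - cnj \<mu> * (cnj (v$2))\<^sup>2"
    "of_real r = (\<mu> * v$1 * v$2 + cnj \<mu> * cnj (v$1) * cnj (v$2)) / 2"
proof
  \<comment> \<open>Found by solving the two target equations for the phase: after substituting
    them, the numerator collapses to \<open>\<mu>\<close> times the fourth power of the norm of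
    \<open>v\<close>, that is, to 4 times \<open>\<mu>\<close>.\<close>
  define \<mu> where "\<mu> = (p * (cnj (v$1))\<^sup>2 + 4 * of_real r * cnj (v$1) * cnj (v$2) - cnj p * (cnj (v$2))\<^sup>2) / 4"
  have cmu: "cnj \<mu> = (cnj p * (v$1)\<^sup>2 + 4 * of_real r * v$1 * v$2 - p * (v$2)\<^sup>2) / 4"
    by (simp add: \<mu>_def)
  note t' = t[unfolded torus_rel_complex]
  \<comment> \<open>Conjugates are treated as independent variables. Each identity holds up to a
    multiple of the torus relation.\<close>
  have alg: "4 * p = (p * zb\<^sup>2 + 4 * r * zb * wb - pb * wb\<^sup>2) * z\<^sup>2 - (pb * z\<^sup>2 + 4 * r * z * w - p * w\<^sup>2) * wb\<^sup>2
     \<and> 8 * r = (p * zb\<^sup>2 + 4 * r * zb * wb - pb * wb\<^sup>2) * z * w + (pb * z\<^sup>2 + 4 * r * z * w - p * w\<^sup>2) * zb * wb"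
    if "2 * r * (w * wb - z * zb) + (p * zb * w + pb * z * wb) = 0" "z * zb + w * wb = 2"
    for p pb r z zb w wb :: complex
  proof
    have "4 * p = p * (z * zb + w * wb)\<^sup>2" using that by simp
    also have "\<dots> = (p * zb\<^sup>2 + 4 * r * zb * wb - pb * wb\<^sup>2) * z\<^sup>2 - (pb * z\<^sup>2 + 4 * r * z * w - p * w\<^sup>2) * wb\<^sup>2
        + 2 * z * wb * (2 * r * (w * wb - z * zb) + (p * zb * w + pb * z * wb))"
      by (simp add: power2_eq_square algebra_simps)
    finally show "4 * p = (p * zb\<^sup>2 + 4 * r * zb * wb - pb * wb\<^sup>2) * z\<^sup>2 - (pb * z\<^sup>2 + 4 * r * z * w - p * w\<^sup>2) * wb\<^sup>2"
      using that(1) by simp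
    have "8 * r = 2 * r * (z * zb + w * wb)\<^sup>2" using that by simp
    also have "\<dots> = (p * zb\<^sup>2 + 4 * r * zb * wb - pb * wb\<^sup>2) * z * w + (pb * z\<^sup>2 + 4 * r * z * w - p * w\<^sup>2) * zb * wb
       + (w * wb - z * zb) * (2 * r * (w * wb - z * zb) + (p * zb * w + pb * z * wb))"
      by (simp add: power2_eq_square algebra_simps)
    finally show "8 * r = (p * zb\<^sup>2 + 4 * r * zb * wb - pb * wb\<^sup>2) * z * w + (pb * z\<^sup>2 + 4 * r * z * w - p * w\<^sup>2) * zb * wb"
      using that(1) by simp
  qed
  note a = alg[OF t' n]
  have "4 * p = 4 * (\<mu> * (v$1)\<^sup>2 - cnj \<mu> * (cnj (v$2))\<^sup>2)"
    using a[THEN conjunct1] unfolding cmu \<mu>_def by (simp add: right_diff_distrib)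
  then show p: "p = \<mu> * (v$1)\<^sup>2 - cnj \<mu> * (cnj (v$2))\<^sup>2" by (simp only: mult_cancel_left) simp
  have "8 * complex_of_real r = 8 * ((\<mu> * v$1 * v$2 + cnj \<mu> * cnj (v$1) * cnj (v$2)) / 2)"
    using a[THEN conjunct2] unfolding cmu \<mu>_def by (simp add: distrib_left)
  then show r: "of_real r = (\<mu> * v$1 * v$2 + cnj \<mu> * cnj (v$1) * cnj (v$2)) / 2"
    by (simp only: mult_cancel_left) simp
  have cp: "cnj p = cnj \<mu> * (cnj (v$1))\<^sup>2 - \<mu> * (v$2)\<^sup>2" using arg_cong[OF p, of cnj] by simp
  have "p * cnj p + 4 * (of_real r)\<^sup>2 = \<mu> * cnj \<mu> * (v$1 * cnj (v$1) + v$2 * cnj (v$2))\<^sup>2"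
    unfolding cp r by (subst p) (simp add: power2_eq_square algebra_simps)
  then show "\<mu> * cnj \<mu> = 1" unfolding pr n by simp
qed

text \<open>The converse of \<open>torus_rel_phase\<close>. The relation is a formal identity after
  substitution, and the length of the pole comes from that of \<open>v\<close>.\<close>

lemma phase_torus_rel:
  fixes v :: "complex^2"
  assumes E: "\<mu> * cnj \<mu> = 1" and n: "v$1 * cnj (v$1) + v$2 * cnj (v$2) = 2"
  defines "p \<equiv> \<mu> * (v$1)\<^sup>2 - cnj \<mu> * (cnj (v$2))\<^sup>2" and "r \<equiv> Re (\<mu> * (v$1 * v$2))"
  shows "torus_rel p r v" "p * cnj p + 4 * (of_real r)\<^sup>2 = 4"
proof -
  have r: "2 * of_real r = \<mu> * v$1 * v$2 + cnj \<mu> * cnj (v$1) * cnj (v$2)"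
    using complex_add_cnj[of "\<mu> * (v$1 * v$2)"] by (simp add: r_def mult.assoc)
  have cp: "cnj p = cnj \<mu> * (cnj (v$1))\<^sup>2 - \<mu> * (v$2)\<^sup>2" by (simp add: p_def)
  show "torus_rel p r v"
    unfolding torus_rel_complex r cp p_def by (simp add: power2_eq_square algebra_simps)
  have "p * cnj p + 4 * (of_real r)\<^sup>2 = p * cnj p + (2 * of_real r)\<^sup>2" by simp
  also have "\<dots> = (\<mu> * cnj \<mu>) * (v$1 * cnj (v$1) + v$2 * cnj (v$2))\<^sup>2"
    unfolding r cp p_def by (simp add: power2_eq_square algebra_simps)
  finally show "p * cnj p + 4 * (of_real r)\<^sup>2 = 4" unfolding E n by simp
qed

text \<open>
  \<open>(dz, dw)\<close> is the derivative of \<open>\<phi> = (z, w)\<close> in some direction, decomposed along the unitary frame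
  \<open>\<phi>\<close>, \<open>(- cnj w, cnj z)\<close>; both coefficients are real up to the phases \<open>\<i>\<close> and \<open>\<i> E\<close>.
\<close>

locale tangent_direction =
  fixes z w dz dw E :: complex and \<theta> \<kappa> :: real
  assumes E: "E * cnj E = 1" and norm2: "cnj z * z + cnj w * w = 2"
    and hp: "cnj z * dz + cnj w * dw = \<i> * of_real \<theta>"
    and cd: "z * dw - w * dz = \<i> * of_real \<kappa> * E"
begin

lemma dz: "2 * dz = \<i> * of_real \<theta> * z - \<i> * of_real \<kappa> * E * cnj w"
proof -
  have "2 * dz = (cnj z * z + cnj w * w) * dz" by (simp add: norm2)
  also have "\<dots> = (cnj z * dz + cnj w * dw) * z - (z * dw - w * dz) * cnj w" by (simp add: algebra_simps)
  finally show ?thesis unfolding hp cd .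
qed

lemma dw: "2 * dw = \<i> * of_real \<theta> * w + \<i> * of_real \<kappa> * E * cnj z"
proof -
  have "2 * dw = (cnj z * z + cnj w * w) * dw" by (simp add: norm2)
  also have "\<dots> = (cnj z * dz + cnj w * dw) * w + (z * dw - w * dz) * cnj z" by (simp add: algebra_simps)
  finally show ?thesis unfolding hp cd .
qed

lemma cnj_dz: "2 * cnj dz = - \<i> * of_real \<theta> * cnj z + \<i> * of_real \<kappa> * cnj E * w"
  using arg_cong[OF dz, of cnj] by simp

lemma cnj_dw: "2 * cnj dw = - \<i> * of_real \<theta> * cnj w - \<i> * of_real \<kappa> * cnj E * z"
  using arg_cong[OF dw, of cnj] by simp

text \<open>The \<open>\<theta>\<close> terms cancel because \<open>E\<close> turns at rate
  \<open>\<theta>\<close>, which is exactly how fast \<open>z\<^sup>2\<close> turns along the Hopf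
  circle. The \<open>\<kappa>\<close> terms of the two summands cancel each other.\<close>

lemma p_derivative_0:
  "cnj (\<i> * of_real \<theta> * E) * z\<^sup>2 + cnj E * (2 * z * dz)
    - (\<i> * of_real \<theta> * E * (cnj w)\<^sup>2 + E * (2 * cnj w * cnj dw)) = 0"
proof -
  have "cnj (\<i> * of_real \<theta> * E) = - \<i> * of_real \<theta> * cnj E" by simp
  then show ?thesis using E dz cnj_dw by algebra
qed

text \<open>Again the \<open>\<theta>\<close> terms cancel, but here a \<open>\<kappa>\<close> term
  survives. It is \<open>\<i>\<close> times a real number, which is why only the real part of
  \<open>cnj E * z * w\<close> is an invariant.\<close>

lemma r_derivative_0:
  "Re (cnj (\<i> * of_real \<theta> * E) * (z * w) + cnj E * (dz * w + z * dw)) = 0"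
proof -
  have "cnj (\<i> * of_real \<theta> * E) = - \<i> * of_real \<theta> * cnj E" by simp
  then have "2 * (cnj (\<i> * of_real \<theta> * E) * (z * w) + cnj E * (dz * w + z * dw)) = \<i> * of_real \<kappa> * (z * cnj z - w * cnj w)"
    using E dz dw by algebra
  also have "\<dots> = \<i> * of_real (\<kappa> * ((cmod z)\<^sup>2 - (cmod w)\<^sup>2))"
    by (simp only: complex_norm_square[symmetric] of_real_mult of_real_diff of_real_power) simp
  finally have "Re (2 * (cnj (\<i> * of_real \<theta> * E) * (z * w) + cnj E * (dz * w + z * dw))) = 0" by simp
  then show ?thesis by simp
qed

text \<open>Infinitesimal rigidity: a great circle through the Hopf image of the point that is also
  tangent to its motion has its pole fixed up to sign. In terms of phases, \<open>\<mu> * E\<close>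
  must be real. A nonzero \<open>\<kappa>\<close> ensures that the Hopf image really moves.\<close>

lemma torus_rel_derivative:
  assumes \<kappa>: "\<kappa> \<noteq> 0" and p: "p = \<mu> * z\<^sup>2 - cnj \<mu> * (cnj w)\<^sup>2"
    and r: "of_real r = (\<mu> * z * w + cnj \<mu> * cnj z * cnj w) / 2"
    and d: "r * (2 * Re (cnj w * dw) - 2 * Re (cnj z * dz)) + Re (p * (cnj dz * w + cnj z * dw)) = 0"
  shows "Im (\<mu> * E) = 0"
proof -
  \<comment> \<open>A complex quantity whose real part is the derivative in \<open>d\<close>; the
    formulas for \<open>dz\<close> and \<open>dw\<close> can be substituted in it
    algebraically.\<close>
  define X where "X = r * (2 * (cnj w * dw - cnj z * dz)) + p * (cnj dz * w + cnj z * dw)"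
  have "2 * X = of_real r * (4 * \<i> * of_real \<kappa> * E * cnj z * cnj w) + of_real r * (2 * \<i> * of_real \<theta> * (w * cnj w - z * cnj z))
     + p * (\<i> * of_real \<kappa> * (cnj E * w\<^sup>2 + E * (cnj z)\<^sup>2))"
    unfolding X_def using dz dw cnj_dz by algebra
  also have "\<dots> = \<i> * of_real \<kappa> * ((\<mu> * z * w + cnj \<mu> * cnj z * cnj w) * (2 * E * cnj z * cnj w)
      + (\<mu> * z\<^sup>2 - cnj \<mu> * (cnj w)\<^sup>2) * (cnj E * w\<^sup>2 + E * (cnj z)\<^sup>2))
      + of_real r * (2 * \<i> * of_real \<theta> * (w * cnj w - z * cnj z))"
    unfolding p r by (simp add: algebra_simps)
  also have "(\<mu> * z * w + cnj \<mu> * cnj z * cnj w) * (2 * E * cnj z * cnj w)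
      + (\<mu> * z\<^sup>2 - cnj \<mu> * (cnj w)\<^sup>2) * (cnj E * w\<^sup>2 + E * (cnj z)\<^sup>2)
     = \<mu> * E * ((cnj z * z + cnj w * w)\<^sup>2) - (\<mu> * E + cnj (\<mu> * E)) * (cnj w * w)\<^sup>2
      + (cnj \<mu> * E * (cnj z)\<^sup>2 * (cnj w)\<^sup>2 + \<mu> * cnj E * z\<^sup>2 * w\<^sup>2)"
    by (simp add: power2_eq_square algebra_simps)
  \<comment> \<open>Apart from 4 times \<open>\<mu> * E\<close> every term is real, so after the
    factor \<open>\<i> * of_real \<kappa>\<close> only Im (\<open>\<mu> * E\<close>) is left in the
    real part.\<close>
  also have "\<dots> = 4 * (\<mu> * E) - of_real (2 * Re (\<mu> * E) * ((cmod w)\<^sup>2)\<^sup>2) + of_real (2 * Re (\<mu> * cnj E * z\<^sup>2 * w\<^sup>2))"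
  proof -
    have "(\<mu> * E + cnj (\<mu> * E)) * (cnj w * w)\<^sup>2 = of_real (2 * Re (\<mu> * E) * ((cmod w)\<^sup>2)\<^sup>2)"
    proof -
      have "cnj w * w = of_real ((cmod w)\<^sup>2)" by (simp only: complex_norm_square mult.commute)
      moreover have "\<mu> * E + cnj (\<mu> * E) = of_real (2 * Re (\<mu> * E))" by (rule complex_add_cnj)
      ultimately show ?thesis by (simp only: of_real_mult of_real_power)
    qed
    moreover have "cnj \<mu> * E * (cnj z)\<^sup>2 * (cnj w)\<^sup>2 + \<mu> * cnj E * z\<^sup>2 * w\<^sup>2 = of_real (2 * Re (\<mu> * cnj E * z\<^sup>2 * w\<^sup>2))"
      using complex_add_cnj[of "\<mu> * cnj E * z\<^sup>2 * w\<^sup>2"] by (simp add: add.commute)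
    ultimately show ?thesis unfolding norm2 by simp
  qed
  also have "of_real r * (2 * \<i> * of_real \<theta> * (w * cnj w - z * cnj z)) = \<i> * of_real (2 * r * \<theta> * ((cmod w)\<^sup>2 - (cmod z)\<^sup>2))"
    by (simp add: complex_norm_square[symmetric])
  finally have X: "2 * X = \<i> * of_real \<kappa> * (4 * (\<mu> * E) - of_real (2 * Re (\<mu> * E) * ((cmod w)\<^sup>2)\<^sup>2) + of_real (2 * Re (\<mu> * cnj E * z\<^sup>2 * w\<^sup>2)))
     + \<i> * of_real (2 * r * \<theta> * ((cmod w)\<^sup>2 - (cmod z)\<^sup>2))" .
  have "Re (2 * X) = - 4 * \<kappa> * Im (\<mu> * E)"
    unfolding X by simp
  moreover have "Re X = 0" using d by (simp add: X_def)
  ultimately show ?thesis using \<kappa> by simp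
qed

end

section \<open>The Lagrangian angle and the pole of the Hopf projection\<close>

locale spherical_lagrangian_chart = shrinker_chart +
  assumes lag: "\<And>u. u \<in> V \<Longrightarrow> kaehler (fu f u) (fv f u) = 0"
    and sphere: "\<And>u. u \<in> V \<Longrightarrow> f u \<bullet> f u = 2"
begin

definition df where "df u h = (h$1) *\<^sub>R fu f u + (h$2) *\<^sub>R fv f u" for h :: "real^2"
definition D where "D u = cdet (fu f u) (fv f u)"
definition E where "E u = D u / of_real (cmod (D u))"
definition \<theta> where "\<theta> u h = kaehler (f u) (df u h)"
text \<open>Twice the coefficient of \<open>\<i> * E * (- cnj w, cnj z)\<close> in the derivative of
  (z, w); it measures the motion transversal to the Hopf circle.\<close>

definition \<kappa> where "\<kappa> u h = Im (cnj (E u) * cdet (f u) (df u h))"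

lemma H_eq: "u \<in> V \<Longrightarrow> mean_curv f u = - f u"
  and radial: "u \<in> V \<Longrightarrow> f u \<bullet> fu f u = 0" "u \<in> V \<Longrightarrow> f u \<bullet> fv f u = 0"
  using spherical_chart sphere by blast+

lemma hprod_partials:
  assumes "u \<in> V"
  shows "hprod (fu f u) (fu f u) = of_real (g11 f u)" "hprod (fu f u) (fv f u) = of_real (g12 f u)"
    "hprod (fv f u) (fu f u) = of_real (g12 f u)" "hprod (fv f u) (fv f u) = of_real (g22 f u)"
  using lag[OF assms] kaehler_self[of "fu f u"] kaehler_self[of "fv f u"] Re_hprod_commute[of "fv f u" "fu f u"]
    Im_hprod_commute[of "fv f u" "fu f u"]
  by (simp_all add: complex_eq_iff kaehler_eq_Im_hprod g11_def g12_def g22_def inner_eq_Re_hprod)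

lemma cmod_D:
  assumes "u \<in> V"
  shows "(cmod (D u))\<^sup>2 = gdet f u" "D u \<noteq> 0"
proof -
  have "of_real ((cmod (D u))\<^sup>2) = cnj (D u) * D u"
    by (simp only: complex_norm_square mult.commute)
  also have "\<dots> = of_real (gdet f u)"
    unfolding D_def cnj_cdet_mult_cdet hprod_partials[OF assms] by (simp add: gdet_def power2_eq_square)
  finally show 1: "(cmod (D u))\<^sup>2 = gdet f u" by (simp only: of_real_eq_iff)
  show "D u \<noteq> 0" using 1 gdet_pos[OF assms] by auto
qed

lemma E_unit: "u \<in> V \<Longrightarrow> E u * cnj (E u) = 1"
proof -
  assume "u \<in> V"
  then have "cmod (E u) = 1" using cmod_D(2) by (simp add: E_def norm_divide)
  then show ?thesis by (simp add: complex_norm_square[symmetric])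
qed

text \<open>Obtained by differentiating the Lagrangian condition. Together with the symmetry of
  second derivatives, these two equations are the total symmetry of the cubic form <sigma(.,.),
  J.>.\<close>

lemma kaehler_symmetric:
  assumes u: "u \<in> V"
  shows "kaehler (fu f u) (fuv f u) = kaehler (fv f u) (fuu f u)"
    "kaehler (fu f u) (fvv f u) = kaehler (fv f u) (fuv f u)"
proof -
  note d = has_jet2D[OF jet u]
  have "((\<lambda>u. Jc (fu f u) \<bullet> fv f u) has_derivative
     (\<lambda>h. Jc (fu f u) \<bullet> ((h$1) *\<^sub>R fuv f u + (h$2) *\<^sub>R fvv f u) + Jc ((h$1) *\<^sub>R fuu f u + (h$2) *\<^sub>R fuv f u) \<bullet> fv f u)) (at u)"
    by (rule has_derivative_inner[OF bounded_linear.has_derivative[OF bounded_linear_Jc d(2)] d(3)])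
  moreover have "((\<lambda>u. Jc (fu f u) \<bullet> fv f u) has_derivative (\<lambda>h. 0)) (at u)"
    by (rule has_derivative_transform_within_open[of "\<lambda>u. 0", OF has_derivative_const open_V u])
      (use lag in \<open>simp add: kaehler_def\<close>)
  ultimately have "(\<lambda>h::real^2. Jc (fu f u) \<bullet> ((h$1) *\<^sub>R fuv f u + (h$2) *\<^sub>R fvv f u)
      + Jc ((h$1) *\<^sub>R fuu f u + (h$2) *\<^sub>R fuv f u) \<bullet> fv f u) = (\<lambda>h. 0)"
    by (rule has_derivative_unique)
  then have "(h$1) * kaehler (fu f u) (fuv f u) + (h$2) * kaehler (fu f u) (fvv f u)
    + ((h$1) * kaehler (fuu f u) (fv f u) + (h$2) * kaehler (fuv f u) (fv f u)) = 0" for h :: "real^2"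
    unfolding kaehler_def[symmetric] kaehler_add_scaled fun_eq_iff by blast
  from this[of e1] this[of e2]
  show "kaehler (fu f u) (fuv f u) = kaehler (fv f u) (fuu f u)"
    "kaehler (fu f u) (fvv f u) = kaehler (fv f u) (fuv f u)"
    using kaehler_commute[of "fuu f u" "fv f u"] kaehler_commute[of "fuv f u" "fv f u"]
    by (simp_all add: e1_def e2_def axis_def)
qed

text \<open>If the Kaehler form pairs \<open>a\<close> to zero with the frame, then J a is normal
  and pairing with it ignores tangential parts. The trace can therefore be taken over raw second
  derivatives, and H = -f evaluates it.\<close>

lemma kaehler_trace:
  assumes u: "u \<in> V" and a: "kaehler a (fu f u) = 0" "kaehler a (fv f u) = 0"
  shows "gi11 f u * kaehler a (fuu f u) + 2 * gi12 f u * kaehler a (fuv f u) + gi22 f u * kaehler a (fvv f u)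
    = kaehler (f u) a"
proof -
  have add: "kaehler a (x + y) = kaehler a x + kaehler a y" "kaehler a (x - y) = kaehler a x - kaehler a y"
    "kaehler a (c *\<^sub>R x) = c * kaehler a x" "kaehler a (- x) = - kaehler a x" for x y c
    by (simp_all add: kaehler_def inner_add_right inner_diff_right)
  have "kaehler a (mean_curv f u) = gi11 f u * kaehler a (fuu f u) + 2 * gi12 f u * kaehler a (fuv f u) + gi22 f u * kaehler a (fvv f u)"
    unfolding mean_curv_eq nor_proj_def tan_proj_eq by (simp add: add a trace_hess_def)
  moreover have "kaehler a (mean_curv f u) = kaehler (f u) a"
    using H_eq[OF u] kaehler_commute[of a "f u"] by (simp add: add)
  ultimately show ?thesis by simp
qed

text \<open>The derivative of the argument of \<open>D\<close> is a trace of the cubic form with a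
  tangent vector in one slot. By total symmetry the trace can be moved to the other two slots, where
  it yields H and hence \<open>\<theta>\<close>.\<close>

lemma D_derivative:
  assumes u: "u \<in> V"
  defines "D' \<equiv> \<lambda>h::real^2. cdet ((h$1) *\<^sub>R fuu f u + (h$2) *\<^sub>R fuv f u) (fv f u) + cdet (fu f u) ((h$1) *\<^sub>R fuv f u + (h$2) *\<^sub>R fvv f u)"
  shows "(D has_derivative D') (at u)" "Im (cnj (D u) * D' h) = \<theta> u h * (cmod (D u))\<^sup>2"
proof -
  note d = has_jet2D[OF jet u]
  note c = bounded_linear.has_derivative[OF bounded_linear_vec_nth]
  show "(D has_derivative D') (at u)"
    unfolding D_def[abs_def] cdet_def D'_def
    by (rule has_derivative_eq_rhs, rule has_derivative_diff, rule has_derivative_mult[OF c[OF d(2)] c[OF d(3)]],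
        rule has_derivative_mult[OF c[OF d(2)] c[OF d(3)]]) (simp add: fun_eq_iff algebra_simps)
  have lin: "cnj (D u) * D' h = of_real (h$1) * (cnj (D u) * cdet (fuu f u) (fv f u) + cnj (D u) * cdet (fu f u) (fuv f u))
     + of_real (h$2) * (cnj (D u) * cdet (fuv f u) (fv f u) + cnj (D u) * cdet (fu f u) (fvv f u))"
    unfolding D'_def cdet_def by (simp add: scaleR_conv_of_real[where 'a = complex] algebra_simps)
  note L = lag[OF u]
  have L': "kaehler (fv f u) (fu f u) = 0" using L kaehler_commute[of "fv f u" "fu f u"] by simp
  have g: "gdet f u \<noteq> 0" using gdet_pos[OF u] by simp
  \<comment> \<open>The trace formula with the denominators of the inverse metric cleared, matching
    the Gram entries that Cauchy-Binet produces.\<close>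
  have tr: "g22 f u * kaehler a (fuu f u) - 2 * g12 f u * kaehler a (fuv f u) + g11 f u * kaehler a (fvv f u)
    = gdet f u * kaehler (f u) a" if "kaehler a (fu f u) = 0" "kaehler a (fv f u) = 0" for a
    using kaehler_trace[OF u that] g by (simp add: gi11_def gi12_def gi22_def divide_simps mult.commute split: if_splits)
  note sym = kaehler_symmetric[OF u]
  have I1: "Im (cnj (D u) * cdet (fuu f u) (fv f u) + cnj (D u) * cdet (fu f u) (fuv f u)) = gdet f u * kaehler (f u) (fu f u)"
    using tr[OF kaehler_self L] sym
    unfolding D_def cnj_cdet_mult_cdet hprod_partials[OF u] by (simp add: kaehler_eq_Im_hprod algebra_simps)
  have I2: "Im (cnj (D u) * cdet (fuv f u) (fv f u) + cnj (D u) * cdet (fu f u) (fvv f u)) = gdet f u * kaehler (f u) (fv f u)"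
    using tr[OF L' kaehler_self] sym
    unfolding D_def cnj_cdet_mult_cdet hprod_partials[OF u] by (simp add: kaehler_eq_Im_hprod algebra_simps)
  show "Im (cnj (D u) * D' h) = \<theta> u h * (cmod (D u))\<^sup>2"
  proof -
    have *: "Im (of_real a * x + of_real b * y) = a * Im x + b * Im y" for a b x y by simp
    show ?thesis
      unfolding lin * I1 I2 cmod_D(1)[OF u] \<theta>_def df_def kaehler_add_scaled by (simp add: algebra_simps)
  qed
qed

lemma E_derivative:
  assumes "u \<in> V"
  shows "(E has_derivative (\<lambda>h. \<i> * of_real (\<theta> u h) * E u)) (at u)"
  unfolding E_def[abs_def] by (rule has_derivative_phase[OF D_derivative(1)[OF assms] cmod_D(2)[OF assms] D_derivative(2)[OF assms]])

text \<open>Normality of \<open>f\<close> makes its hermitian products with tangent vectors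
  imaginary. Gram entries of the frame are real, so by Cauchy-Binet
  \<open>cnj (D u) * cdet (f u) (df u h)\<close> is imaginary as well.\<close>

lemma tangent_dir:
  assumes u: "u \<in> V"
  shows "tangent_direction (f u $ 1) (f u $ 2) (df u h $ 1) (df u h $ 2) (E u) (\<theta> u h) (\<kappa> u h)"
proof
  show "E u * cnj (E u) = 1" by (rule E_unit[OF u])
  have "hprod (f u) (f u) = 2"
    using sphere[OF u] kaehler_self[of "f u"] by (simp add: complex_eq_iff inner_eq_Re_hprod kaehler_eq_Im_hprod)
  then show "cnj (f u $ 1) * f u $ 1 + cnj (f u $ 2) * f u $ 2 = 2" by (simp add: hprod_def)
  have "f u \<bullet> df u h = 0" using radial[OF u] by (simp add: df_def inner_add_right)
  then have "hprod (f u) (df u h) = \<i> * of_real (\<theta> u h)"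
    by (simp add: complex_eq_iff inner_eq_Re_hprod \<theta>_def kaehler_eq_Im_hprod)
  then show "cnj (f u $ 1) * df u h $ 1 + cnj (f u $ 2) * df u h $ 2 = \<i> * of_real (\<theta> u h)"
    by (simp add: hprod_def)
  have re0: "Re (hprod (fu f u) (f u)) = 0" "Re (hprod (fv f u) (f u)) = 0"
    using radial[OF u] by (simp_all add: inner_commute flip: inner_eq_Re_hprod)
  have hd: "hprod a (df u h) = of_real (h$1) * hprod a (fu f u) + of_real (h$2) * hprod a (fv f u)" for a
    by (simp add: hprod_def df_def scaleR_conv_of_real[where 'a = complex] algebra_simps)
  have "Re (cnj (D u) * cdet (f u) (df u h)) = 0"
    unfolding D_def cnj_cdet_mult_cdet hd hprod_partials[OF u] using re0 by simp
  then have "Re (cnj (E u) * cdet (f u) (df u h)) = 0" by (simp add: E_def)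
  then have "cnj (E u) * cdet (f u) (df u h) = \<i> * of_real (\<kappa> u h)"
    by (simp add: complex_eq_iff \<kappa>_def)
  then have "E u * cnj (E u) * cdet (f u) (df u h) = \<i> * of_real (\<kappa> u h) * E u"
    by (simp add: mult_ac)
  then show "f u $ 1 * df u h $ 2 - f u $ 2 * df u h $ 1 = \<i> * of_real (\<kappa> u h) * E u"
    by (simp add: E_unit[OF u] cdet_def)
qed

text \<open>Otherwise both frame vectors would be complex multiples of \<open>f u\<close>, and their
  complex determinant would vanish.\<close>

lemma kappa_nonzero:
  assumes u: "u \<in> V"
  shows "\<exists>h. \<kappa> u h \<noteq> 0"
proof (rule ccontr)
  assume "\<nexists>h. \<kappa> u h \<noteq> 0"
  then have k: "\<kappa> u h = 0" for h by blast
  have z: "cdet (f u) (df u h) = 0" for h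
    using tangent_direction.cd[OF tangent_dir[OF u, of h]] k by (simp add: cdet_def)
  have "df u e1 = fu f u" "df u e2 = fv f u" by (simp_all add: df_def e1_def e2_def axis_def)
  with z[of e1] z[of e2] have z': "cdet (f u) (fu f u) = 0" "cdet (f u) (fv f u) = 0" by simp_all
  have "hprod (f u) (f u) * D u = hprod (f u) (fu f u) * cdet (f u) (fv f u) - hprod (f u) (fv f u) * cdet (f u) (fu f u)"
    unfolding D_def hprod_def cdet_def by (simp add: algebra_simps)
  moreover have "hprod (f u) (f u) \<noteq> 0"
    using sphere[OF u] by (auto simp: inner_eq_Re_hprod)
  ultimately show False using z' cmod_D(2)[OF u] by simp
qed

text \<open>The map (|z|^2 - |w|^2, 2 cnj z w) is the Hopf map. Its derivative sends the surface
  normal \<open>E * (- cnj w, cnj z)\<close> to twice (-2R, cnj P), a vector orthogonal to both the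
  Hopf image and its velocity: the pole of the tangent great circle.\<close>

definition P where "P u = cnj (E u) * (f u $ 1)\<^sup>2 - E u * (cnj (f u $ 2))\<^sup>2"
definition R where "R u = Re (cnj (E u) * (f u $ 1 * f u $ 2))"

lemma f_comp_derivative: "u \<in> V \<Longrightarrow> ((\<lambda>u. f u $ i) has_derivative (\<lambda>h. df u h $ i)) (at u)"
  using bounded_linear.has_derivative[OF bounded_linear_vec_nth has_jet2D(1)[OF jet], of u i] by (simp add: df_def)

lemma P_derivative:
  assumes u: "u \<in> V"
  shows "(P has_derivative (\<lambda>h. 0)) (at u)"
proof -
  have "(P has_derivative (\<lambda>h. cnj (\<i> * of_real (\<theta> u h) * E u) * (f u $ 1)\<^sup>2 + cnj (E u) * (2 * f u $ 1 * df u h $ 1)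
    - (\<i> * of_real (\<theta> u h) * E u * (cnj (f u $ 2))\<^sup>2 + E u * (2 * cnj (f u $ 2) * cnj (df u h $ 2))))) (at u)"
    unfolding P_def[abs_def]
    by (auto intro!: derivative_eq_intros f_comp_derivative[OF u] E_derivative[OF u] simp: fun_eq_iff algebra_simps)
  then show ?thesis
    unfolding tangent_direction.p_derivative_0[OF tangent_dir[OF u]] .
qed

lemma R_derivative:
  assumes u: "u \<in> V"
  shows "(R has_derivative (\<lambda>h. 0)) (at u)"
proof -
  have "(R has_derivative (\<lambda>h. Re (cnj (\<i> * of_real (\<theta> u h) * E u) * (f u $ 1 * f u $ 2)
      + cnj (E u) * (df u h $ 1 * f u $ 2 + f u $ 1 * df u h $ 2)))) (at u)"
    unfolding R_def[abs_def]
    by (rule has_derivative_Re, rule has_derivative_eq_rhs, rule has_derivative_mult,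
        rule has_derivative_cnj, rule E_derivative[OF u], rule has_derivative_mult,
        rule f_comp_derivative[OF u], rule f_comp_derivative[OF u])
      (simp add: fun_eq_iff algebra_simps)
  then show ?thesis
    unfolding tangent_direction.r_derivative_0[OF tangent_dir[OF u]] .
qed

lemma norm_components: "u \<in> V \<Longrightarrow> f u $ 1 * cnj (f u $ 1) + f u $ 2 * cnj (f u $ 2) = 2"
  using tangent_direction.norm2[OF tangent_dir] by (simp add: mult.commute)

lemma PR_torus_rel:
  assumes u: "u \<in> V"
  shows "torus_rel (P u) (R u) (f u)" "P u * cnj (P u) + 4 * (of_real (R u))\<^sup>2 = 4"
  using phase_torus_rel[of "cnj (E u)" "f u"] E_unit[OF u] norm_components[OF u]
  by (simp_all add: P_def R_def mult.commute[of "cnj (E u)" "E u"])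

lemma PR_constant:
  assumes S: "open S" "connected S" "S \<subseteq> V" and "u \<in> S" "u' \<in> S"
  shows "P u = P u'" "R u = R u'"
  using has_derivative_zero_unique_connected[OF S(1,2), of P u u'] P_derivative
    has_derivative_zero_unique_connected[OF S(1,2), of R u u'] R_derivative assms by blast+

text \<open>On an open set the relation may be differentiated, in particular in a direction with
  nonzero \<open>\<kappa>\<close>. Then \<open>\<mu> * E u\<close> is real and of modulus 1, and the
  two signs give the two alternatives.\<close>

lemma torus_rel_unique:
  assumes W: "open W" "W \<subseteq> V" "u \<in> W" and t: "\<And>u. u \<in> W \<Longrightarrow> torus_rel p r (f u)"
    and pr: "p * cnj p + 4 * (of_real r)\<^sup>2 = 4"
  shows "(p = P u \<and> r = R u) \<or> (p = - P u \<and> r = - R u)"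
proof -
  have u: "u \<in> V" using W by auto
  obtain \<mu> where mu: "\<mu> * cnj \<mu> = 1" "p = \<mu> * (f u $ 1)\<^sup>2 - cnj \<mu> * (cnj (f u $ 2))\<^sup>2"
    "of_real r = (\<mu> * f u $ 1 * f u $ 2 + cnj \<mu> * cnj (f u $ 1) * cnj (f u $ 2)) / 2"
    using torus_rel_phase[OF t[OF W(3)] norm_components[OF u] pr] by blast
  obtain h where h: "\<kappa> u h \<noteq> 0" using kappa_nonzero[OF u] by blast
  define g where "g u = r * (f u $ 2 \<bullet> f u $ 2 - f u $ 1 \<bullet> f u $ 1) + Re (p * (cnj (f u $ 1) * f u $ 2))" for u
  have "(g has_derivative (\<lambda>h. r * ((f u $ 2 \<bullet> df u h $ 2 + df u h $ 2 \<bullet> f u $ 2) - (f u $ 1 \<bullet> df u h $ 1 + df u h $ 1 \<bullet> f u $ 1))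
      + Re (p * (cnj (f u $ 1) * df u h $ 2 + cnj (df u h $ 1) * f u $ 2)))) (at u)"
    unfolding g_def[abs_def]
    by (intro has_derivative_add has_derivative_mult_right has_derivative_diff has_derivative_inner
        has_derivative_Re has_derivative_mult has_derivative_cnj f_comp_derivative[OF u])
  moreover have "(g has_derivative (\<lambda>h. 0)) (at u)"
  proof (rule has_derivative_transform_within_open[of "\<lambda>u. 0", OF has_derivative_const W(1,3)])
    show "0 = g x" if "x \<in> W" for x
      using t[OF that] by (simp add: torus_rel_def g_def power2_norm_eq_inner mult.assoc)
  qed
  ultimately have "r * ((f u $ 2 \<bullet> df u h $ 2 + df u h $ 2 \<bullet> f u $ 2) - (f u $ 1 \<bullet> df u h $ 1 + df u h $ 1 \<bullet> f u $ 1))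
      + Re (p * (cnj (f u $ 1) * df u h $ 2 + cnj (df u h $ 1) * f u $ 2)) = 0"
    using has_derivative_unique by (metis (no_types, lifting))
  then have d: "r * (2 * Re (cnj (f u $ 2) * df u h $ 2) - 2 * Re (cnj (f u $ 1) * df u h $ 1))
      + Re (p * (cnj (df u h $ 1) * f u $ 2 + cnj (f u $ 1) * df u h $ 2)) = 0"
    by (simp add: inner_complex_def algebra_simps)
  have "Im (\<mu> * E u) = 0"
    by (rule tangent_direction.torus_rel_derivative[OF tangent_dir[OF u] h mu(2,3) d])
  moreover have "(\<mu> * E u) * cnj (\<mu> * E u) = 1"
  proof -
    have "(\<mu> * E u) * cnj (\<mu> * E u) = (\<mu> * cnj \<mu>) * (E u * cnj (E u))" by simp
    then show ?thesis using mu(1) E_unit[OF u] by simp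
  qed
  ultimately have "(Re (\<mu> * E u))\<^sup>2 = 1"
    by (simp add: complex_eq_iff power2_eq_square)
  then have "\<mu> * E u = 1 \<or> \<mu> * E u = - 1"
    using \<open>Im (\<mu> * E u) = 0\<close> by (auto simp: power2_eq_1_iff complex_eq_iff)
  then have "\<mu> * E u * cnj (E u) = cnj (E u) \<or> \<mu> * E u * cnj (E u) = - cnj (E u)" by auto
  then have mu': "\<mu> = cnj (E u) \<or> \<mu> = - cnj (E u)" using E_unit[OF u] by (simp add: mult.assoc)
  have r: "r = Re (\<mu> * (f u $ 1 * f u $ 2))"
  proof -
    have e: "\<mu> * f u $ 1 * f u $ 2 + cnj \<mu> * cnj (f u $ 1) * cnj (f u $ 2) = of_real (2 * Re (\<mu> * (f u $ 1 * f u $ 2)))"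
      using complex_add_cnj[of "\<mu> * (f u $ 1 * f u $ 2)"] by (simp only: complex_cnj_mult mult.assoc)
    have "complex_of_real r = of_real (Re (\<mu> * (f u $ 1 * f u $ 2)))"
      unfolding mu(3) e by (simp only: of_real_mult of_real_numeral) simp
    then show ?thesis by (simp only: of_real_eq_iff)
  qed
  from mu' show ?thesis
    unfolding mu(2) r P_def R_def by auto
qed

text \<open>A unique continuation principle: \<open>W\<close> identifies (p, r) with the pole up to
  sign, the pole is constant on the connected set \<open>S\<close>, and the relation does not see
  the sign.\<close>

lemma torus_rel_propagates:
  assumes S: "open S" "connected S" "S \<subseteq> V" and W: "open W" "W \<subseteq> S" "W \<noteq> {}"
    and t: "\<And>u. u \<in> W \<Longrightarrow> torus_rel p r (f u)" and pr: "p * cnj p + 4 * (of_real r)\<^sup>2 = 4"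
    and u: "u \<in> S"
  shows "torus_rel p r (f u)"
proof -
  obtain w where w: "w \<in> W" using W by blast
  have "P u = P w" "R u = R w" using PR_constant[OF S u] w W by auto
  then have "torus_rel (P w) (R w) (f u)" using PR_torus_rel(1)[of u] u S by auto
  moreover have "(p = P w \<and> r = R w) \<or> (p = - P w \<and> r = - R w)"
    using torus_rel_unique[OF W(1) _ w t pr] W S by auto
  ultimately show ?thesis by (auto simp: torus_rel_uminus)
qed

end

section \<open>The Clifford torus\<close>

text \<open>The universal covering of the Clifford torus. Through it the final open-closed argument
  takes place in the connected plane of angles.\<close>

definition cis2 :: "real^2 \<Rightarrow> complex^2" where
  "cis2 y = (\<chi> i. cis (y $ i))"

lemma clifford_eq_cis2:
  assumes "v \<in> clifford_torus"
  obtains y where "v = cis2 y"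
proof
  have n: "cmod (v $ i) = 1" for i
    using assms exhaust_2[of i] by (auto simp: clifford_torus_def)
  show "v = cis2 (\<chi> i. Arg (v $ i))"
    unfolding cis2_def vec_eq_iff
  proof
    fix i
    show "v $ i = (\<chi> i. cis ((\<chi> i. Arg (v $ i)) $ i)) $ i"
      using n[of i] cis_Arg[of "v $ i"] by (cases "v $ i = 0") (auto simp: sgn_div_norm)
  qed
qed

lemma continuous_cis2: "continuous_on S cis2"
  unfolding cis2_def by (intro continuous_intros)

text \<open>On the right half of the unit circle the imaginary part is a coordinate.\<close>

lemma unit_complex_eq_cis:
  assumes "cmod a = 1" "Re a > 0" "Im a = sin t" "cos t > 0"
  shows "a = cis t"
proof -
  have "(Re a)\<^sup>2 + (sin t)\<^sup>2 = 1" using cmod_power2[of a] assms by simp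
  then have "(Re a)\<^sup>2 = (cos t)\<^sup>2" using sin_cos_squared_add[of t] by linarith
  then have "Re a = cos t" using assms(2,4) by (simp add: power2_eq_iff)
  then show ?thesis using assms(3) by (simp add: complex_eq_iff)
qed

lemma has_derivative_vec_lambda:
  fixes f :: "'n::finite \<Rightarrow> 'a::real_normed_vector \<Rightarrow> real"
  assumes "\<And>i. (f i has_derivative f' i) (at a within S)"
  shows "((\<lambda>x. \<chi> i. f i x) has_derivative (\<lambda>h. \<chi> i. f' i h)) (at a within S)"
  by (rule has_derivative_componentwise_within[THEN iffD2]) (use assms in \<open>auto simp: Basis_vec_def inner_axis\<close>)

text \<open>After rotating \<open>F u\<^sub>0\<close> to (1, 1), imaginary parts are local
  coordinates of the torus. In them \<open>F\<close> becomes a map \<open>\<psi>\<close> of the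
  plane with invertible derivative at \<open>u\<^sub>0\<close>, to which the open mapping theorem of
  Sussmann applies.\<close>

lemma immersion_into_clifford_open:
  fixes F :: "real^2 \<Rightarrow> complex^2"
  assumes V: "open V" "u\<^sub>0 \<in> V" and cont: "continuous_on V F"
    and der: "(F has_derivative F') (at u\<^sub>0)" and inj: "\<And>h. F' h = 0 \<Longrightarrow> h = 0"
    and cliff: "\<And>u. u \<in> V \<Longrightarrow> F u \<in> clifford_torus" and y0: "F u\<^sub>0 = cis2 y\<^sub>0"
  shows "\<exists>\<delta>>0. \<forall>y\<in>ball y\<^sub>0 \<delta>. cis2 y \<in> F ` V"
proof -
  have unit: "cmod (F u $ i) = 1" if "u \<in> V" for u i
    using cliff[OF that] exhaust_2[of i] by (auto simp: clifford_torus_def)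
  define a where "a u i = cis (- (y\<^sub>0 $ i)) * F u $ i" for u i
  define \<psi> :: "real^2 \<Rightarrow> real^2" where "\<psi> u = (\<chi> i. Im (a u i))" for u
  define \<psi>' :: "real^2 \<Rightarrow> real^2" where "\<psi>' h = (\<chi> i. Im (cis (- (y\<^sub>0 $ i)) * F' h $ i))" for h
  have d\<psi>: "(\<psi> has_derivative \<psi>') (at u\<^sub>0)"
    unfolding \<psi>_def[abs_def] \<psi>'_def[abs_def] a_def
    by (intro has_derivative_vec_lambda has_derivative_Im has_derivative_mult_right
        bounded_linear.has_derivative[OF bounded_linear_vec_nth] der)
  have lin\<psi>: "linear \<psi>'" using d\<psi> by (rule has_derivative_linear)
  have "inj \<psi>'"
  proof (rule linear_injective_0[OF lin\<psi>, THEN iffD2], intro allI impI)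
    fix h assume h0: "\<psi>' h = 0"
    have "F' h $ i = 0" for i
    proof -
      have c: "((\<lambda>u. F u $ i) has_derivative (\<lambda>h. F' h $ i)) (at u\<^sub>0)"
        by (rule bounded_linear.has_derivative[OF bounded_linear_vec_nth der])
      \<comment> \<open>The modulus of each component of \<open>F\<close> is constant, so the
        rotated derivative has no real part; its imaginary part vanishes by
        \<open>h0\<close>.\<close>
      have "((\<lambda>u. F u $ i \<bullet> F u $ i) has_derivative (\<lambda>h. F u\<^sub>0 $ i \<bullet> F' h $ i + F' h $ i \<bullet> F u\<^sub>0 $ i)) (at u\<^sub>0)"
        by (rule has_derivative_inner[OF c c])
      moreover have "((\<lambda>u. F u $ i \<bullet> F u $ i) has_derivative (\<lambda>h. 0)) (at u\<^sub>0)"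
        by (rule has_derivative_transform_within_open[of "\<lambda>u. 1", OF has_derivative_const V])
          (use unit in \<open>simp add: dot_square_norm\<close>)
      ultimately have "F u\<^sub>0 $ i \<bullet> F' h $ i + F' h $ i \<bullet> F u\<^sub>0 $ i = 0"
        using has_derivative_unique by (metis (no_types, lifting))
      then have "F u\<^sub>0 $ i \<bullet> F' h $ i = 0" by (simp add: inner_commute)
      then have "Re (cis (- (y\<^sub>0 $ i)) * F' h $ i) = 0"
        by (simp add: y0 cis2_def inner_complex_def)
      moreover have "Im (cis (- (y\<^sub>0 $ i)) * F' h $ i) = 0"
        using h0 unfolding \<psi>'_def vec_eq_iff by simp
      ultimately have "cis (- (y\<^sub>0 $ i)) * F' h $ i = 0" by (simp only: complex_eq_iff zero_complex.sel)
      then show ?thesis by simp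
    qed
    then have "F' h = 0" by (simp add: vec_eq_iff)
    then show "h = 0" by (rule inj)
  qed
  then have "surj \<psi>'" using lin\<psi> linear_injective_imp_surjective by blast
  then obtain g' where g': "linear g'" "\<psi>' \<circ> g' = id"
    using linear_surjective_right_inverse[OF lin\<psi>] by blast
  have cont_a: "continuous_on V (\<lambda>u. a u i)" for i
    unfolding a_def by (intro continuous_intros cont)
  \<comment> \<open>Positive real parts ensure that equal imaginary parts mean equal points.\<close>
  define T where "T = {u \<in> V. \<forall>i. Re (a u i) > 0}"
  have T_eq: "T = (\<Inter>i. V \<inter> (\<lambda>u. Re (a u i)) -` {0<..})" unfolding T_def by auto
  have "open (V \<inter> (\<lambda>u. Re (a u i)) -` {0<..})" for i
    using V(1) by (intro continuous_open_preimage continuous_intros cont_a) auto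
  then have "open T" unfolding T_eq by (intro open_INT) auto
  have a0: "a u\<^sub>0 i = 1" for i by (simp add: a_def y0 cis2_def cis_mult)
  have "u\<^sub>0 \<in> T" using V a0 by (simp add: T_def)
  have "continuous_on V \<psi>" unfolding \<psi>_def by (intro continuous_intros cont_a)
  then have "\<psi> u\<^sub>0 \<in> interior (\<psi> ` T)"
    using sussmann_open_mapping[OF V(1) _ V(2) d\<psi>, of g' T] g' \<open>open T\<close> \<open>u\<^sub>0 \<in> T\<close>
    by (auto simp: T_def linear_conv_bounded_linear interior_open)
  moreover have "\<psi> u\<^sub>0 = 0" by (simp add: \<psi>_def a0 vec_eq_iff)
  ultimately have int0: "0 \<in> interior (\<psi> ` T)" by simp
  define S :: "real^2 \<Rightarrow> real^2" where "S y = (\<chi> i. sin (y $ i - y\<^sub>0 $ i))" for y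
  have contS: "continuous_on UNIV S" unfolding S_def by (intro continuous_intros)
  define O1 where "O1 = S -` interior (\<psi> ` T) \<inter> (\<Inter>i. (\<lambda>y. cos (y $ i - y\<^sub>0 $ i)) -` {0<..})"
  have "open O1"
    unfolding O1_def
  proof (intro open_Int open_INT ballI)
    show "open (S -` interior (\<psi> ` T))" using contS by (intro open_vimage) auto
    show "open ((\<lambda>y. cos (y $ i - y\<^sub>0 $ i)) -` {0<..})" for i
      by (intro open_vimage continuous_intros)
  qed simp
  moreover have "y\<^sub>0 \<in> O1"
  proof -
    have "S y\<^sub>0 = 0" by (simp add: S_def vec_eq_iff)
    then show ?thesis using int0 by (simp add: O1_def)
  qed
  ultimately obtain \<delta> where \<delta>: "\<delta> > 0" "ball y\<^sub>0 \<delta> \<subseteq> O1" using open_contains_ball by blast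
  have "cis2 y \<in> F ` V" if "y \<in> O1" for y
  proof -
    have "S y \<in> \<psi> ` T" using that interior_subset by (auto simp: O1_def)
    then obtain u where u: "u \<in> T" "S y = \<psi> u" by auto
    have uV: "u \<in> V" using u by (simp add: T_def)
    have "F u $ i = cis (y $ i)" for i
    proof -
      have "a u i = cis (y $ i - y\<^sub>0 $ i)"
      proof (rule unit_complex_eq_cis)
        show "cmod (a u i) = 1" using unit[OF uV] by (simp add: a_def norm_mult)
        show "Re (a u i) > 0" using u by (simp add: T_def)
        show "Im (a u i) = sin (y $ i - y\<^sub>0 $ i)" using u(2) by (simp add: S_def \<psi>_def vec_eq_iff)
        show "cos (y $ i - y\<^sub>0 $ i) > 0" using that by (simp add: O1_def)
      qed
      then have "cis (y\<^sub>0 $ i) * a u i = cis (y\<^sub>0 $ i) * cis (y $ i - y\<^sub>0 $ i)" by simp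
      then show ?thesis by (simp add: a_def cis_mult flip: mult.assoc)
    qed
    then have "F u = cis2 y" by (simp add: cis2_def vec_eq_iff)
    then show ?thesis using uV by (metis imageI)
  qed
  then show ?thesis using \<delta> by blast
qed

text \<open>For \<open>\<alpha>\<^sup>2 + (cmod \<beta>)\<^sup>2 = 1\<close> an element of SU(2).
  Its diagonal is real, so the inverse just changes the sign of \<open>\<beta>\<close>; such
  elements suffice to move the equator to any great circle.\<close>

definition unitary2 :: "real \<Rightarrow> complex \<Rightarrow> complex^2 \<Rightarrow> complex^2" where
  "unitary2 \<alpha> \<beta> v = vector [of_real \<alpha> * v$1 - cnj \<beta> * v$2, \<beta> * v$1 + of_real \<alpha> * v$2]"

lemma unitary2_nth: "unitary2 \<alpha> \<beta> v $ 1 = of_real \<alpha> * v$1 - cnj \<beta> * v$2" "unitary2 \<alpha> \<beta> v $ 2 = \<beta> * v$1 + of_real \<alpha> * v$2"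
  by (simp_all add: unitary2_def vector_2)

lemma linear_unitary2: "linear (unitary2 \<alpha> \<beta>)"
  by (rule linearI) (simp_all add: vec_eq_iff forall_2 unitary2_nth algebra_simps)

lemma norm_squared_complex2: "complex_of_real (v \<bullet> v) = v$1 * cnj (v$1) + v$2 * cnj (v$2)" for v :: "complex^2"
  unfolding complex_norm_square[symmetric] by (simp add: inner_vec_def sum_2 dot_square_norm)

text \<open>Presents the torus as the preimage of the equator under the Hopf map on the sphere of
  radius sqrt 2.\<close>

lemma clifford_torus_iff: "v \<in> clifford_torus \<longleftrightarrow> v \<bullet> v = 2 \<and> (cmod (v$1))\<^sup>2 = (cmod (v$2))\<^sup>2"
proof -
  have vv: "v \<bullet> v = (cmod (v$1))\<^sup>2 + (cmod (v$2))\<^sup>2" by (simp add: inner_vec_def sum_2 dot_square_norm)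
  have n: "cmod z = 1 \<longleftrightarrow> (cmod z)\<^sup>2 = 1" for z by (simp add: power2_eq_1_iff) (smt (verit) norm_ge_zero)
  show ?thesis unfolding clifford_torus_def mem_Collect_eq n vv by argo
qed

context
  fixes \<alpha> :: real and \<beta> :: complex
  assumes unit: "\<alpha>\<^sup>2 + (cmod \<beta>)\<^sup>2 = 1"
begin

lemma unit_complex: "of_real \<alpha> * of_real \<alpha> + \<beta> * cnj \<beta> = (1::complex)"
proof -
  have "of_real \<alpha> * of_real \<alpha> + \<beta> * cnj \<beta> = complex_of_real (\<alpha>\<^sup>2 + (cmod \<beta>)\<^sup>2)"
    by (simp add: complex_norm_square[symmetric] power2_eq_square)
  then show ?thesis using unit by simp
qed

lemma unitary2_inverse: "unitary2 \<alpha> \<beta> (unitary2 \<alpha> (- \<beta>) v) = v" "unitary2 \<alpha> (- \<beta>) (unitary2 \<alpha> \<beta> v) = v"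
proof -
  have "x = (of_real \<alpha> * of_real \<alpha> + \<beta> * cnj \<beta>) * x" for x using unit_complex by simp
  from this[of "v$1"] this[of "v$2"]
  show "unitary2 \<alpha> \<beta> (unitary2 \<alpha> (- \<beta>) v) = v" "unitary2 \<alpha> (- \<beta>) (unitary2 \<alpha> \<beta> v) = v"
    by (simp_all add: vec_eq_iff forall_2 unitary2_nth algebra_simps)
qed

lemma inner_unitary2: "unitary2 \<alpha> \<beta> v \<bullet> unitary2 \<alpha> \<beta> v = v \<bullet> v"
proof -
  have "complex_of_real (unitary2 \<alpha> \<beta> v \<bullet> unitary2 \<alpha> \<beta> v) = (of_real \<alpha> * of_real \<alpha> + \<beta> * cnj \<beta>) * (v$1 * cnj (v$1) + v$2 * cnj (v$2))"
    unfolding norm_squared_complex2 unitary2_nth by (simp add: algebra_simps)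
  also have "\<dots> = complex_of_real (v \<bullet> v)" unfolding unit_complex norm_squared_complex2 by simp
  finally show ?thesis by (simp only: of_real_eq_iff)
qed

text \<open>The coefficients arise by substituting the inverse matrix into the equation |z|^2 =
  |w|^2 and collecting terms.\<close>

lemma torus_rel_unitary2:
  "torus_rel (4 * of_real \<alpha> * cnj \<beta>) ((cmod \<beta>)\<^sup>2 - \<alpha>\<^sup>2) (unitary2 \<alpha> \<beta> v) \<longleftrightarrow> (cmod (v$1))\<^sup>2 = (cmod (v$2))\<^sup>2"
proof -
  have r: "complex_of_real ((cmod \<beta>)\<^sup>2 - \<alpha>\<^sup>2) = \<beta> * cnj \<beta> - of_real \<alpha> * of_real \<alpha>"
    by (simp add: complex_norm_square[symmetric] power2_eq_square)
  have "2 * complex_of_real ((cmod \<beta>)\<^sup>2 - \<alpha>\<^sup>2) * (unitary2 \<alpha> \<beta> v $ 2 * cnj (unitary2 \<alpha> \<beta> v $ 2) - unitary2 \<alpha> \<beta> v $ 1 * cnj (unitary2 \<alpha> \<beta> v $ 1))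
     + ((4 * of_real \<alpha> * cnj \<beta>) * cnj (unitary2 \<alpha> \<beta> v $ 1) * unitary2 \<alpha> \<beta> v $ 2 + cnj (4 * of_real \<alpha> * cnj \<beta>) * unitary2 \<alpha> \<beta> v $ 1 * cnj (unitary2 \<alpha> \<beta> v $ 2))
    = 2 * (of_real \<alpha> * of_real \<alpha> + \<beta> * cnj \<beta>)\<^sup>2 * (v$1 * cnj (v$1) - v$2 * cnj (v$2))"
    unfolding r unitary2_nth by (simp add: power2_eq_square algebra_simps)
  also have "\<dots> = of_real (2 * ((cmod (v$1))\<^sup>2 - (cmod (v$2))\<^sup>2))"
    unfolding unit_complex by (simp add: complex_norm_square[symmetric])
  finally have "torus_rel (4 * of_real \<alpha> * cnj \<beta>) ((cmod \<beta>)\<^sup>2 - \<alpha>\<^sup>2) (unitary2 \<alpha> \<beta> v) \<longleftrightarrow> 2 * ((cmod (v$1))\<^sup>2 - (cmod (v$2))\<^sup>2) = 0"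
    unfolding torus_rel_complex by (simp only: of_real_eq_0_iff)
  then show ?thesis by simp
qed

end

lemma torus_rel_parameters:
  assumes pr: "p * cnj p + 4 * (of_real r)\<^sup>2 = 4"
  obtains \<alpha> \<beta> where "\<alpha>\<^sup>2 + (cmod \<beta>)\<^sup>2 = 1"
    "\<And>v. torus_rel p r v \<longleftrightarrow> torus_rel (4 * of_real \<alpha> * cnj \<beta>) ((cmod \<beta>)\<^sup>2 - \<alpha>\<^sup>2) v"
proof -
  have *: "\<exists>\<alpha> \<beta>. \<alpha>\<^sup>2 + (cmod \<beta>)\<^sup>2 = 1 \<and> p = 4 * of_real \<alpha> * cnj \<beta> \<and> r = (cmod \<beta>)\<^sup>2 - \<alpha>\<^sup>2"
    if pr: "p * cnj p + 4 * (of_real r)\<^sup>2 = 4" and r: "r \<le> 0" for p r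
  proof -
    \<comment> \<open>Forced by the sum 1 and the difference \<open>r\<close> of
      \<open>(cmod \<beta>)\<^sup>2\<close> and \<open>\<alpha>\<^sup>2\<close>. The sign of
      \<open>r\<close> keeps \<open>\<alpha>\<close> away from 0, so \<open>\<beta>\<close> can be
      obtained from \<open>p\<close> by division.\<close>
    define \<alpha> where "\<alpha> = sqrt ((1 - r) / 2)"
    define \<beta> where "\<beta> = cnj p / (4 * of_real \<alpha>)"
    have a2: "\<alpha>\<^sup>2 = (1 - r) / 2" using r by (simp add: \<alpha>_def)
    have a: "\<alpha> > 0" using r by (simp add: \<alpha>_def)
    have "complex_of_real ((cmod p)\<^sup>2 + 4 * r\<^sup>2) = of_real 4"
      using pr by (simp add: complex_norm_square[symmetric])
    then have p2: "(cmod p)\<^sup>2 = 4 - 4 * r\<^sup>2" by (simp only: of_real_eq_iff)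
    have "(cmod \<beta>)\<^sup>2 = (cmod p)\<^sup>2 / (16 * \<alpha>\<^sup>2)"
      using a by (simp add: \<beta>_def norm_divide norm_mult power_divide power_mult_distrib)
    also have "\<dots> = (1 + r) / 2"
      unfolding p2 a2 using r by (simp add: field_simps power2_eq_square)
    finally have b2: "(cmod \<beta>)\<^sup>2 = (1 + r) / 2" .
    have "p = 4 * of_real \<alpha> * cnj \<beta>" using a by (simp add: \<beta>_def)
    then show ?thesis using a2 b2 by (intro exI[of _ \<alpha>] exI[of _ \<beta>]) (auto simp: field_simps)
  qed
  show ?thesis
  proof (cases "r \<le> 0")
    case True
    then show ?thesis using *[OF pr] that by blast
  next
    case False
    \<comment> \<open>For positive \<open>r\<close> the opposite pole describes the same
      torus.\<close>
    then obtain \<alpha> \<beta> where "\<alpha>\<^sup>2 + (cmod \<beta>)\<^sup>2 = 1" and e: "- p = 4 * of_real \<alpha> * cnj \<beta>" "- r = (cmod \<beta>)\<^sup>2 - \<alpha>\<^sup>2"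
      using *[of "- p" "- r"] pr by auto
    moreover have "torus_rel p r v \<longleftrightarrow> torus_rel (4 * of_real \<alpha> * cnj \<beta>) ((cmod \<beta>)\<^sup>2 - \<alpha>\<^sup>2) v" for v
      unfolding e[symmetric] torus_rel_uminus ..
    ultimately show ?thesis using that by blast
  qed
qed

section \<open>Globalisation\<close>

lemma chart_openin_image:
  assumes c: "imm_chart M \<phi> x V" and U: "open U" "U \<subseteq> V"
  shows "openin M (x ` U)"
proof -
  have "open V" and V: "openin M (x ` V)" and h: "homeomorphic_map (top_of_set V) (subtopology M (x ` V)) x"
    using c by (auto simp: imm_chart_def)
  then have "openin (top_of_set V) U" using U by (simp add: openin_open_eq)
  then have "openin (subtopology M (x ` V)) (x ` U)"
    using homeomorphic_imp_open_map[OF h] by (simp add: open_map_def)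
  then show ?thesis using V openin_trans_full by blast
qed

lemma chart_open_preimage:
  assumes c: "imm_chart M \<phi> x V" and S: "openin M S"
  shows "open {u \<in> V. x u \<in> S}"
proof -
  have V: "open V" "openin M (x ` V)" and h: "homeomorphic_map (top_of_set V) (subtopology M (x ` V)) x"
    using c by (auto simp: imm_chart_def)
  have "continuous_map (top_of_set V) M x"
    using homeomorphic_imp_continuous_map[OF h] by (simp add: continuous_map_in_subtopology)
  then have "openin (top_of_set V) {u \<in> topspace (top_of_set V). x u \<in> S}"
    using S by (rule openin_continuous_map_preimage)
  then show ?thesis using V(1) by (simp add: openin_open_eq)
qed

text \<open>Charts are homeomorphisms onto open sets, so continuity of \<open>\<phi>\<close> can be
  read off from that of \<open>\<phi> \<circ> x\<close>.\<close>

lemma immersed_surface_continuous: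
  assumes "compact_immersed_surface M \<phi>"
  shows "continuous_map M euclidean \<phi>"
  unfolding continuous_map_def
proof (intro conjI allI impI)
  show "\<phi> \<in> topspace M \<rightarrow> topspace euclidean" by simp
  fix T :: "(complex^2) set" assume "openin euclidean T"
  then have T: "open T" by simp
  show "openin M {q \<in> topspace M. \<phi> q \<in> T}"
  proof (subst openin_subopen, intro ballI)
    fix q assume q: "q \<in> {q \<in> topspace M. \<phi> q \<in> T}"
    then obtain x V where c: "imm_chart M \<phi> x V" and qV: "q \<in> x ` V"
      using assms by (auto simp: compact_immersed_surface_def)
    interpret immersion_chart V "\<phi> \<circ> x" using c by unfold_locales (auto simp: imm_chart_def)
    have "open (V \<inter> (\<phi> \<circ> x) -` T)" using cont(1) open_V T by (rule continuous_open_preimage)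
    then have o: "openin M (x ` (V \<inter> (\<phi> \<circ> x) -` T))" using chart_openin_image[OF c] by auto
    show "\<exists>S. openin M S \<and> q \<in> S \<and> S \<subseteq> {q \<in> topspace M. \<phi> q \<in> T}"
      using o qV q openin_subset[OF o] by (intro exI[of _ "x ` (V \<inter> (\<phi> \<circ> x) -` T)"]) auto
  qed
qed

lemma closedin_if_complement_locally_open:
  assumes "S \<subseteq> topspace M" "\<And>q. q \<in> topspace M \<Longrightarrow> q \<notin> S \<Longrightarrow> \<exists>O'. openin M O' \<and> q \<in> O' \<and> O' \<inter> S = {}"
  shows "closedin M S"
proof -
  have "openin M (topspace M - S)"
  proof (subst openin_subopen, intro ballI)
    fix q assume "q \<in> topspace M - S"
    then obtain O' where "openin M O'" "q \<in> O'" "O' \<inter> S = {}" using assms(2) by blast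
    then show "\<exists>T. openin M T \<and> q \<in> T \<and> T \<subseteq> topspace M - S" using openin_subset by blast
  qed
  then show ?thesis using assms(1) by (simp add: closedin_def)
qed

section \<open>Constancy of the distance to the origin\<close>

locale compact_shrinker =
  fixes M :: "'a topology" and \<phi> :: "'a \<Rightarrow> complex^2"
  assumes surf: "compact_immersed_surface M \<phi>" and lagr: "lagrangian M \<phi>" and shrink: "self_shrinker M \<phi>"
begin

lemma chart_at: "q \<in> topspace M \<Longrightarrow> \<exists>x V u. imm_chart M \<phi> x V \<and> u \<in> V \<and> x u = q"
  using surf unfolding compact_immersed_surface_def by (metis imageE)

lemma shrinker_chart: "imm_chart M \<phi> x V \<Longrightarrow> shrinker_chart V (\<phi> \<circ> x)"
  using shrink by unfold_locales (auto simp: imm_chart_def self_shrinker_def)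

lemma chart_in_topspace: "imm_chart M \<phi> x V \<Longrightarrow> u \<in> V \<Longrightarrow> x u \<in> topspace M"
  unfolding imm_chart_def using openin_subset by blast

lemma clopen_eq_topspace: "openin M S \<Longrightarrow> closedin M S \<Longrightarrow> S \<noteq> {} \<Longrightarrow> S = topspace M"
  using surf unfolding compact_immersed_surface_def connected_space_clopen_in by blast

lemma compact_image: "compact (\<phi> ` topspace M)" "\<phi> ` topspace M \<noteq> {}"
proof -
  have "compactin M (topspace M)" using surf by (simp add: compact_immersed_surface_def compact_space_def)
  then show "compact (\<phi> ` topspace M)"
    using image_compactin[OF _ immersed_surface_continuous[OF surf]] by (simp add: compactin_euclidean_iff)
  show "\<phi> ` topspace M \<noteq> {}" using surf by (simp add: compact_immersed_surface_def)
qed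

text \<open>Compactness provides a maximum of \<open>c\<close> times the squared norm. The set where
  it is attained is closed by continuity and open by the strong maximum principle in charts, hence
  all of M.\<close>

lemma norm_squared_constant:
  assumes H: "H_sq_holds M \<phi> (\<lambda>t. 0 \<le> c * (2 - t))" and c: "c \<noteq> 0"
  shows "\<exists>m. \<forall>q\<in>topspace M. \<phi> q \<bullet> \<phi> q = m"
proof -
  have "continuous_on (\<phi> ` topspace M) (\<lambda>v. c * (v \<bullet> v))" by (intro continuous_intros)
  then obtain q0 where q0: "q0 \<in> topspace M" "\<And>q. q \<in> topspace M \<Longrightarrow> c * (\<phi> q \<bullet> \<phi> q) \<le> c * (\<phi> q0 \<bullet> \<phi> q0)"
    using continuous_attains_sup[OF compact_image] by blast
  define m where "m = c * (\<phi> q0 \<bullet> \<phi> q0)"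
  define S where "S = {q \<in> topspace M. c * (\<phi> q \<bullet> \<phi> q) = m}"
  have cm: "continuous_map M euclidean (\<lambda>q. c * (\<phi> q \<bullet> \<phi> q))"
    using continuous_map_compose[OF immersed_surface_continuous[OF surf], of euclidean "\<lambda>v. c * (v \<bullet> v)"]
    by (simp add: o_def continuous_intros)
  have "closedin M {q \<in> topspace M. c * (\<phi> q \<bullet> \<phi> q) \<in> {m}}"
    by (rule closedin_continuous_map_preimage[OF cm]) simp
  then have "closedin M S" by (simp add: S_def)
  moreover have "openin M S"
  proof (subst openin_subopen, intro ballI)
    fix q assume q: "q \<in> S"
    then obtain x V u where ch: "imm_chart M \<phi> x V" "u \<in> V" "x u = q"
      using chart_at[of q] by (auto simp: S_def)
    interpret shrinker_chart V "\<phi> \<circ> x" by (rule shrinker_chart[OF ch(1)])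
    have "\<exists>\<delta>>0. ball u \<delta> \<subseteq> V \<and> (\<forall>w\<in>ball u \<delta>. c * ((\<phi> \<circ> x) w \<bullet> (\<phi> \<circ> x) w) = m)"
    proof (rule norm_squared_locally_constant)
      show "0 \<le> c * (2 - (norm (mean_curv (\<phi> \<circ> x) w))\<^sup>2)" if "w \<in> V" for w
        using H ch(1) that by (auto simp: H_sq_holds_def)
      show "c * ((\<phi> \<circ> x) w \<bullet> (\<phi> \<circ> x) w) \<le> m" if "w \<in> V" for w
        using q0(2)[OF chart_in_topspace[OF ch(1) that]] by (simp add: m_def)
      show "u \<in> V" by (rule ch(2))
      show "c * ((\<phi> \<circ> x) u \<bullet> (\<phi> \<circ> x) u) = m" using q ch(3) by (simp add: S_def)
    qed
    then obtain \<delta> where \<delta>: "\<delta> > 0" "ball u \<delta> \<subseteq> V" "\<And>w. w \<in> ball u \<delta> \<Longrightarrow> c * (\<phi> (x w) \<bullet> \<phi> (x w)) = m"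
      by auto
    show "\<exists>T. openin M T \<and> q \<in> T \<and> T \<subseteq> S"
    proof (intro exI conjI)
      show "openin M (x ` ball u \<delta>)" by (rule chart_openin_image[OF ch(1) open_ball \<delta>(2)])
      show "q \<in> x ` ball u \<delta>" using ch(3) \<delta>(1) by (metis centre_in_ball imageI)
      show "x ` ball u \<delta> \<subseteq> S" using \<delta>(2,3) chart_in_topspace[OF ch(1)] by (auto simp: S_def)
    qed
  qed
  moreover have "S \<noteq> {}" using q0(1) by (auto simp: S_def m_def)
  ultimately have "S = topspace M" by (intro clopen_eq_topspace)
  then have "\<forall>q\<in>topspace M. c * (\<phi> q \<bullet> \<phi> q) = m" by (auto simp: S_def)
  then show ?thesis using c by (intro exI[of _ "m / c"]) (auto simp: field_simps)
qed

end

section \<open>Identification of the image\<close>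

locale spherical_compact_shrinker = compact_shrinker +
  assumes const: "\<exists>m. \<forall>q\<in>topspace M. \<phi> q \<bullet> \<phi> q = m"
begin

lemma norm_squared_2:
  assumes "q \<in> topspace M"
  shows "\<phi> q \<bullet> \<phi> q = 2"
proof -
  obtain m where m: "\<And>q. q \<in> topspace M \<Longrightarrow> \<phi> q \<bullet> \<phi> q = m" using const by blast
  obtain x V u where ch: "imm_chart M \<phi> x V" "u \<in> V" "x u = q" using chart_at[OF assms] by blast
  have "(\<phi> \<circ> x) u \<bullet> (\<phi> \<circ> x) u = 2"
    using shrinker_chart.spherical_chart(3)[OF shrinker_chart[OF ch(1)], of m u] m ch chart_in_topspace[OF ch(1)]
    by simp
  then show ?thesis using ch(3) by simp
qed

lemma spherical_chart:
  assumes c: "imm_chart M \<phi> x V"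
  shows "spherical_lagrangian_chart V (\<phi> \<circ> x)"
proof -
  interpret shrinker_chart V "\<phi> \<circ> x" by (rule shrinker_chart[OF c])
  show ?thesis
    using lagr c norm_squared_2 chart_in_topspace[OF c] by unfold_locales (auto simp: lagrangian_def)
qed

lemma image_in_torus:
  obtains p r where "p * cnj p + 4 * (of_real r)\<^sup>2 = 4" "\<And>q. q \<in> topspace M \<Longrightarrow> torus_rel p r (\<phi> q)"
proof -
  obtain q0 where q0: "q0 \<in> topspace M" using compact_image(2) by blast
  obtain x0 V0 u0 where ch0: "imm_chart M \<phi> x0 V0" "u0 \<in> V0" "x0 u0 = q0" using chart_at[OF q0] by blast
  interpret c0: spherical_lagrangian_chart V0 "\<phi> \<circ> x0" by (rule spherical_chart[OF ch0(1)])
  define p where "p = c0.P u0"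
  define r where "r = c0.R u0"
  have pr: "p * cnj p + 4 * (of_real r)\<^sup>2 = 4" using c0.PR_torus_rel(2)[OF ch0(2)] by (simp add: p_def r_def)
  \<comment> \<open>The interior of the set where the relation holds. Openness is then automatic,
    and a point of \<open>S\<close> comes with a whole neighbourhood, which is what rigidity
    requires.\<close>
  define S where "S = {q. \<exists>O'. openin M O' \<and> q \<in> O' \<and> (\<forall>y\<in>O'. torus_rel p r (\<phi> y))}"
  have "openin M S"
  proof (subst openin_subopen, intro ballI)
    fix q assume "q \<in> S"
    then obtain O' where "openin M O'" "q \<in> O'" "\<forall>y\<in>O'. torus_rel p r (\<phi> y)" by (auto simp: S_def)
    then show "\<exists>T. openin M T \<and> q \<in> T \<and> T \<subseteq> S" by (intro exI[of _ O']) (auto simp: S_def)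
  qed
  moreover have "q0 \<in> S"
  proof -
    obtain \<delta> where \<delta>: "\<delta> > 0" "ball u0 \<delta> \<subseteq> V0" using c0.open_V ch0(2) open_contains_ball by blast
    have "torus_rel p r (\<phi> (x0 w))" if "w \<in> ball u0 \<delta>" for w
    proof -
      have "c0.P w = p" "c0.R w = r"
        unfolding p_def r_def using c0.PR_constant[OF open_ball connected_ball \<delta>(2) that] \<delta>(1) by auto
      then show ?thesis using c0.PR_torus_rel(1)[of w] that \<delta>(2) by auto
    qed
    moreover have "openin M (x0 ` ball u0 \<delta>)" by (rule chart_openin_image[OF ch0(1) open_ball \<delta>(2)])
    moreover have "q0 \<in> x0 ` ball u0 \<delta>" using ch0(3) \<delta>(1) by (metis centre_in_ball imageI)
    ultimately show ?thesis unfolding S_def by blast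
  qed
  \<comment> \<open>A chart ball about a point outside \<open>S\<close> cannot meet
    \<open>S\<close>: it would satisfy the relation on a nonempty open piece, hence everywhere by
    propagation, and its centre would lie in \<open>S\<close>.\<close>
  moreover have "closedin M S"
  proof (rule closedin_if_complement_locally_open)
    show "S \<subseteq> topspace M" using openin_subset[OF \<open>openin M S\<close>] .
    fix q assume q: "q \<in> topspace M" "q \<notin> S"
    obtain x V u where ch: "imm_chart M \<phi> x V" "u \<in> V" "x u = q" using chart_at[OF q(1)] by blast
    interpret c: spherical_lagrangian_chart V "\<phi> \<circ> x" by (rule spherical_chart[OF ch(1)])
    obtain \<delta> where \<delta>: "\<delta> > 0" "ball u \<delta> \<subseteq> V" using c.open_V ch(2) open_contains_ball by blast
    have o: "openin M (x ` ball u \<delta>)" by (rule chart_openin_image[OF ch(1) open_ball \<delta>(2)])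
    have qo: "q \<in> x ` ball u \<delta>" using ch(3) \<delta>(1) by (metis centre_in_ball imageI)
    have "x ` ball u \<delta> \<inter> S = {}"
    proof (rule ccontr)
      assume "x ` ball u \<delta> \<inter> S \<noteq> {}"
      then obtain w O' where w: "w \<in> ball u \<delta>" "openin M O'" "x w \<in> O'" "\<And>y. y \<in> O' \<Longrightarrow> torus_rel p r (\<phi> y)"
        unfolding S_def by blast
      define W where "W = ball u \<delta> \<inter> {w \<in> V. x w \<in> O'}"
      have "w \<in> W" using w \<delta>(2) by (auto simp: W_def)
      then have W: "open W" "W \<subseteq> ball u \<delta>" "W \<noteq> {}"
        using chart_open_preimage[OF ch(1) w(2)] by (auto simp: W_def)
      have "torus_rel p r ((\<phi> \<circ> x) v)" if "v \<in> ball u \<delta>" for v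
        by (rule c.torus_rel_propagates[OF open_ball connected_ball \<delta>(2) W _ pr that]) (use w(4) in \<open>auto simp: W_def\<close>)
      then have "q \<in> S" using o qo unfolding S_def by auto
      then show False using q(2) by simp
    qed
    then show "\<exists>O'. openin M O' \<and> q \<in> O' \<and> O' \<inter> S = {}" using o qo by blast
  qed
  ultimately have "S = topspace M" using clopen_eq_topspace by blast
  then have "torus_rel p r (\<phi> q)" if "q \<in> topspace M" for q using that unfolding S_def by blast
  then show ?thesis using that pr by blast
qed

lemma image_eq_clifford:
  "\<exists>A :: complex^2 \<Rightarrow> complex^2. linear A \<and> (\<forall>z. norm (A z) = norm z) \<and> \<phi> ` topspace M = A ` clifford_torus"
proof -
  obtain p r where pr: "p * cnj p + 4 * (of_real r)\<^sup>2 = 4" and t: "\<And>q. q \<in> topspace M \<Longrightarrow> torus_rel p r (\<phi> q)"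
    using image_in_torus by blast
  obtain \<alpha> \<beta> where unit: "\<alpha>\<^sup>2 + (cmod \<beta>)\<^sup>2 = 1"
    and tr: "\<And>v. torus_rel p r v \<longleftrightarrow> torus_rel (4 * of_real \<alpha> * cnj \<beta>) ((cmod \<beta>)\<^sup>2 - \<alpha>\<^sup>2) v"
    using torus_rel_parameters[OF pr] by blast
  let ?A = "unitary2 \<alpha> \<beta>" and ?B = "unitary2 \<alpha> (- \<beta>)"
  have B: "?B (\<phi> q) \<in> clifford_torus" if "q \<in> topspace M" for q
  proof -
    have "torus_rel (4 * of_real \<alpha> * cnj \<beta>) ((cmod \<beta>)\<^sup>2 - \<alpha>\<^sup>2) (?A (?B (\<phi> q)))"
      using t[OF that] tr unitary2_inverse(1)[OF unit] by simp
    then have "(cmod (?B (\<phi> q) $ 1))\<^sup>2 = (cmod (?B (\<phi> q) $ 2))\<^sup>2" using torus_rel_unitary2[OF unit] by blast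
    moreover have "?B (\<phi> q) \<bullet> ?B (\<phi> q) = 2"
      using inner_unitary2[of \<alpha> "- \<beta>"] unit norm_squared_2[OF that] by simp
    ultimately show ?thesis unfolding clifford_torus_iff by simp
  qed
  \<comment> \<open>The angles whose torus point is attained by the immersion: closed because the
    image is compact, open because the immersion is open into the torus. Connectedness of the plane
    then gives surjectivity.\<close>
  define Z where "Z = {y. ?A (cis2 y) \<in> \<phi> ` topspace M}"
  have contA: "continuous_on UNIV ?A" using linear_continuous_on linear_conv_bounded_linear linear_unitary2 by blast
  have "closed (\<phi> ` topspace M)" using compact_image(1) by (rule compact_imp_closed)
  moreover have "continuous_on UNIV (\<lambda>y. ?A (cis2 y))"
    using continuous_on_compose2[OF contA continuous_cis2] by blast
  ultimately have "closed ((\<lambda>y. ?A (cis2 y)) -` (\<phi> ` topspace M))"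
    by (rule closed_vimage)
  then have "closed Z" by (simp add: Z_def vimage_def)
  moreover have "open Z"
  proof (rule openI)
    fix y assume "y \<in> Z"
    then obtain q where q: "q \<in> topspace M" "?A (cis2 y) = \<phi> q" by (auto simp: Z_def)
    obtain x V u where ch: "imm_chart M \<phi> x V" "u \<in> V" "x u = q" using chart_at[OF q(1)] by blast
    interpret c: spherical_lagrangian_chart V "\<phi> \<circ> x" by (rule spherical_chart[OF ch(1)])
    have blB: "bounded_linear ?B" using linear_unitary2 linear_conv_bounded_linear by blast
    define F where "F u = ?B (\<phi> (x u))" for u
    have "\<exists>\<delta>>0. \<forall>y'\<in>ball y \<delta>. cis2 y' \<in> F ` V"
    proof (rule immersion_into_clifford_open[OF c.open_V ch(2), where F = F
          and F' = "\<lambda>h. ?B (h$1 *\<^sub>R fu (\<phi> \<circ> x) u + h$2 *\<^sub>R fv (\<phi> \<circ> x) u)"])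
      have "continuous_on V (\<lambda>u. \<phi> (x u))" using c.cont(1) by (simp add: o_def)
      then show "continuous_on V F" unfolding F_def by (rule bounded_linear.continuous_on[OF blB])
      have d: "((\<lambda>u. \<phi> (x u)) has_derivative (\<lambda>h. h$1 *\<^sub>R fu (\<phi> \<circ> x) u + h$2 *\<^sub>R fv (\<phi> \<circ> x) u)) (at u)"
        using has_jet2D(1)[OF c.jet ch(2)] by (simp add: o_def)
      show "(F has_derivative (\<lambda>h. ?B (h$1 *\<^sub>R fu (\<phi> \<circ> x) u + h$2 *\<^sub>R fv (\<phi> \<circ> x) u))) (at u)"
        unfolding F_def[abs_def] by (rule bounded_linear.has_derivative[OF blB d])
      show "h = 0" if "?B (h$1 *\<^sub>R fu (\<phi> \<circ> x) u + h$2 *\<^sub>R fv (\<phi> \<circ> x) u) = 0" for h :: "real^2"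
      proof -
        have "?A (?B (h$1 *\<^sub>R fu (\<phi> \<circ> x) u + h$2 *\<^sub>R fv (\<phi> \<circ> x) u)) = ?A 0" using that by simp
        then have "h$1 *\<^sub>R fu (\<phi> \<circ> x) u + h$2 *\<^sub>R fv (\<phi> \<circ> x) u = 0"
          using unitary2_inverse(1)[OF unit] linear_0[OF linear_unitary2] by metis
        then show ?thesis using c.partials_independent[OF ch(2)] by (simp add: vec_eq_iff forall_2)
      qed
      show "F w \<in> clifford_torus" if "w \<in> V" for w
        unfolding F_def using B chart_in_topspace[OF ch(1) that] by simp
      show "F u = cis2 y" unfolding F_def ch(3) q(2)[symmetric] by (rule unitary2_inverse(2)[OF unit])
    qed
    then obtain \<delta> where \<delta>: "\<delta> > 0" "\<And>y'. y' \<in> ball y \<delta> \<Longrightarrow> cis2 y' \<in> F ` V" by blast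
    have "ball y \<delta> \<subseteq> Z"
    proof
      fix y' assume "y' \<in> ball y \<delta>"
      then obtain w where w: "w \<in> V" "cis2 y' = F w" using \<delta>(2) by blast
      then have "?A (cis2 y') = \<phi> (x w)" using unitary2_inverse(1)[OF unit] by (simp add: F_def)
      then show "y' \<in> Z" using chart_in_topspace[OF ch(1) w(1)] by (simp add: Z_def)
    qed
    then show "\<exists>\<delta>>0. ball y \<delta> \<subseteq> Z" using \<delta>(1) by blast
  qed
  moreover have "Z \<noteq> {}"
  proof -
    obtain q where q: "q \<in> topspace M" using compact_image(2) by blast
    obtain y where "?B (\<phi> q) = cis2 y" using clifford_eq_cis2[OF B[OF q]] .
    then have "?A (cis2 y) = \<phi> q" using unitary2_inverse(1)[OF unit] by metis
    then show ?thesis using q by (auto simp: Z_def)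
  qed
  ultimately have Z: "Z = UNIV" using clopen by blast
  have "\<phi> ` topspace M = ?A ` clifford_torus"
  proof
    show "\<phi> ` topspace M \<subseteq> ?A ` clifford_torus"
      using B unitary2_inverse(1)[OF unit] by (metis image_eqI image_subsetI)
    show "?A ` clifford_torus \<subseteq> \<phi> ` topspace M"
    proof
      fix v assume "v \<in> ?A ` clifford_torus"
      then obtain y where "v = ?A (cis2 y)" using clifford_eq_cis2 by (metis imageE)
      then show "v \<in> \<phi> ` topspace M" using Z by (auto simp: Z_def)
    qed
  qed
  moreover have "norm (?A z) = norm z" for z using inner_unitary2[OF unit, of z] by (simp add: norm_eq_sqrt_inner)
  ultimately show ?thesis using linear_unitary2 by blast
qed

end

theorem theorem1p4:
  fixes M :: "'a topology" and \<phi> :: "'a \<Rightarrow> complex^2"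
  assumes "compact_immersed_surface M \<phi>"
    and "lagrangian M \<phi>"
    and "self_shrinker M \<phi>"
    and "(\<exists>c. H_sq_holds M \<phi> (\<lambda>t. t = c)) \<or> H_sq_holds M \<phi> (\<lambda>t. t \<le> 2)
         \<or> H_sq_holds M \<phi> (\<lambda>t. t \<ge> 2)"
  shows "\<exists>A :: complex^2 \<Rightarrow> complex^2. linear A \<and> (\<forall>z. norm (A z) = norm z) \<and>
           \<phi> ` topspace M = A ` clifford_torus"
proof -
  interpret compact_shrinker M \<phi> using assms by unfold_locales
  \<comment> \<open>A constant is at most 2 or at least 2, so the first hypothesis is a case of the
    other two.\<close>
  have "H_sq_holds M \<phi> (\<lambda>t. t \<le> 2) \<or> H_sq_holds M \<phi> (\<lambda>t. t \<ge> 2)"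
  proof -
    have "H_sq_holds M \<phi> (\<lambda>t. t \<le> 2) \<or> H_sq_holds M \<phi> (\<lambda>t. t \<ge> 2)" if "H_sq_holds M \<phi> (\<lambda>t. t = c)" for c
      using that by (cases "c \<le> 2") (simp_all add: H_sq_holds_def)
    then show ?thesis using assms(4) by blast
  qed
  \<comment> \<open>The multiplier is 1 in the subharmonic case and -1 in the superharmonic
    one.\<close>
  then have "\<exists>c. c \<noteq> 0 \<and> H_sq_holds M \<phi> (\<lambda>t. 0 \<le> c * (2 - t))"
  proof
    assume "H_sq_holds M \<phi> (\<lambda>t. t \<le> 2)"
    then show ?thesis by (intro exI[of _ 1]) (simp add: H_sq_holds_def)
  next
    assume "H_sq_holds M \<phi> (\<lambda>t. t \<ge> 2)"
    then show ?thesis by (intro exI[of _ "- 1"]) (simp add: H_sq_holds_def)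
  qed
  then have "\<exists>m. \<forall>q\<in>topspace M. \<phi> q \<bullet> \<phi> q = m" using norm_squared_constant by blast
  then interpret spherical_compact_shrinker M \<phi> by unfold_locales
  show ?thesis by (rule image_eq_clifford)
qed

end
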